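(* Fix an integer $N\ge 2$. For any $t\in I$, $$\psi_{\rho^t_N}(n)\le\frac{\varepsilon_{N,n}+\varepsilon_{N,n+1}}{1-\varepsilon_{N,n+1}},\qquad n\in\mathbb{N}_+,$$ and $$\psi_{\rho_N}(n)=\varepsilon_{N,n},\qquad n\in\mathbb{N}_+.$$
   Context: Let $I=[0,1]$ with Borel $\sigma$-algebra $\mathcal{B}_I$. The Rényi-type map is $R_N:I\to I$, $R_N(x)=\frac{N}{1-x}-\lfloor\frac{N}{1-x}\rfloor$ for $x\neq 1$, $R_N(1)=0$; its digits are $a_1(x)=\lfloor N/(1-x)\rfloor$ ($x\ne1$), $a_1(1)=\infty$, $a_n(x)=a_1(R_N^{n-1}(x))$ for $n\ge2$. $\rho_N$ is the probability measure $\rho_N(A)=\left(\log\frac{N}{N-1}\right)^{-1}\int_A\frac{dx}{x+N-1}$. For $t\in I$, $\rho^t_N$ is the probability measure with distribution function $\rho^t_N([0,x])=\frac{Nx}{N-(1-x)(1-t)}$. For $k\in\mathbb{N}_+$ let $\mathcal{B}^k_1=\sigma(a_1,\ldots,a_k)$ and $\mathcal{B}^\infty_k=\sigma(a_k,a_{k+1},\ldots)$. For a probability measure $\mu$ on $\mathcal{B}_I$, the $\psi$-mixing coefficients of $(a_n)$ are $\psi_\mu(n)=\sup\left|\frac{\mu(A\cap B)}{\mu(A)\mu(B)}-1\right|$, the supremum over all $k\in\mathbb{N}_+$, $A\in\mathcal{B}^k_1$, $B\in\mathcal{B}^\infty_{k+n}$ with $\mu(A)\mu(B)\ne0$. Also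 $\varepsilon_{N,n}=\sup\left|\frac{\rho^t_N(B)}{\rho_N(B)}-1\right|$, the supremum over all $t\in I$ and $B\in\mathcal{B}^\infty_n$ with $\rho_N(B)>0$. *)

theory Defs
  imports "HOL-Probability.Probability"
begin

definition renyi :: "nat \<Rightarrow> real \<Rightarrow> real" where
  "renyi N x = (if x = 1 then 0 else real N / (1 - x) - of_int \<lfloor>real N / (1 - x)\<rfloor>)"

definition digit1 :: "nat \<Rightarrow> real \<Rightarrow> enat" where
  "digit1 N x = (if x = 1 then \<infinity> else enat (nat \<lfloor>real N / (1 - x)\<rfloor>))"

text \<open>Digits are indexed from 1.\<close>

definition digit :: "nat \<Rightarrow> nat \<Rightarrow> real \<Rightarrow> enat" where
  "digit N n x = digit1 N ((renyi N ^^ (n - 1)) x)"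

definition rho :: "nat \<Rightarrow> real measure" where
  "rho N = density (restrict_space lborel {0..1})
     (\<lambda>x. ennreal (inverse (ln (real N / (real N - 1))) * (1 / (x + real N - 1))))"

definition rho_cdf :: "nat \<Rightarrow> real \<Rightarrow> real \<Rightarrow> real" where
  "rho_cdf N t x = real N * x / (real N - (1 - x) * (1 - t))"

text \<open>The distribution function on the unit interval is extended to the real line by its
  boundary values 0 and 1, so that the library construction applies; the resulting measure
  is then regarded as a measure on the Borel sets of the unit interval.\<close>

definition rho_t :: "nat \<Rightarrow> real \<Rightarrow> real measure" where
  "rho_t N t = restrict_space (interval_measure (\<lambda>x. rho_cdf N t (max 0 (min 1 x)))) {0..1}"

definition digit_algebra :: "nat \<Rightarrow> nat set \<Rightarrow> real set set" where
  "digit_algebra N J = sigma_sets {0..1} {digit N i -` S \<inter> {0..1} | i S. i \<in> J}"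

text \<open>Both coefficients are suprema in the extended reals, so that no boundedness is presupposed.\<close>

definition psi_mixing :: "nat \<Rightarrow> real measure \<Rightarrow> nat \<Rightarrow> ereal" where
  "psi_mixing N \<mu> n =
     Sup {ereal \<bar>measure \<mu> (A \<inter> B) / (measure \<mu> A * measure \<mu> B) - 1\<bar> | k A B.
            k \<ge> 1 \<and> A \<in> digit_algebra N {1..k} \<and> B \<in> digit_algebra N {k + n..} \<and>
            measure \<mu> A * measure \<mu> B \<noteq> 0}"

definition eps :: "nat \<Rightarrow> nat \<Rightarrow> ereal" where
  "eps N n =
     Sup {ereal \<bar>measure (rho_t N t) B / measure (rho N) B - 1\<bar> | t B.
            t \<in> {0..1} \<and> B \<in> digit_algebra N {n..} \<and> measure (rho N) B > 0}"

lemma space_rho [simp]: "space (rho N) = {0..1}"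
  and sets_rho [simp]: "sets (rho N) = sets (restrict_space borel {0..1})"
  by (auto simp: rho_def space_restrict_space sets_restrict_space)

lemma space_rho_t [simp]: "space (rho_t N t) = {0..1}"
  and sets_rho_t [simp]: "sets (rho_t N t) = sets (restrict_space borel {0..1})"
  by (auto simp: rho_t_def space_restrict_space sets_restrict_space)

lemma rho_cdf_denom_pos:
  assumes "N \<ge> 2" "t \<in> {0..1}" "x \<in> {0..1}"
  shows "real N - (1 - x) * (1 - t) > 0"
proof -
  have "(1 - x) * (1 - t) \<le> 1 * 1"
    using assms by (intro mult_mono) auto
  then show ?thesis using assms by simp
qed

lemma rho_cdf_mono:
  assumes "N \<ge> 2" "t \<in> {0..1}" "x \<in> {0..1}" "y \<in> {0..1}" "x \<le> y"
  shows "rho_cdf N t x \<le> rho_cdf N t y"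
proof -
  have "x * (real N - 1 + t) \<le> y * (real N - 1 + t)"
    using assms by (intro mult_right_mono) auto
  then have "x * (real N - (1 - y) * (1 - t)) \<le> y * (real N - (1 - x) * (1 - t))"
    by (simp add: algebra_simps)
  then have "real N * (x * (real N - (1 - y) * (1 - t))) \<le> real N * (y * (real N - (1 - x) * (1 - t)))"
    by (rule mult_left_mono) simp
  then show ?thesis
    using rho_cdf_denom_pos[OF assms(1,2,3)] rho_cdf_denom_pos[OF assms(1,2,4)]
    unfolding rho_cdf_def by (simp add: frac_le_eq divide_le_0_iff mult.assoc)
qed

lemma emeasure_rho_t_Icc:
  assumes "N \<ge> 2" "t \<in> {0..1}" "x \<in> {0..1}"
  shows "emeasure (rho_t N t) {0..x} = ennreal (rho_cdf N t x)"
proof -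
  let ?F = "\<lambda>x. rho_cdf N t (max 0 (min 1 x))"
  have m: "?F a \<le> ?F b" if "a \<le> b" for a b
    using that by (intro rho_cdf_mono[OF assms(1,2)]) auto
  have d: "real N - (1 - max 0 (min 1 x)) * (1 - t) \<noteq> 0" for x
    using rho_cdf_denom_pos[OF assms(1,2), of "max 0 (min 1 x)"] by auto
  have c: "continuous_on UNIV ?F"
    unfolding rho_cdf_def by (intro continuous_intros ballI d)
  have "emeasure (rho_t N t) {0..x} = emeasure (interval_measure ?F) {0..x}"
    unfolding rho_t_def using assms by (subst emeasure_restrict_space) auto
  also have "\<dots> = ?F x - ?F 0"
    by (rule emeasure_interval_measure_Icc[OF _ m c]) (use assms in auto)
  finally show ?thesis using assms by (simp add: rho_cdf_def)
qed

lemma measure_rho_t_Icc: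
  assumes "N \<ge> 2" "t \<in> {0..1}" "x \<in> {0..1}"
  shows "measure (rho_t N t) {0..x} = real N * x / (real N - (1 - x) * (1 - t))"
proof -
  have "rho_cdf N t x \<ge> 0"
    using rho_cdf_denom_pos[OF assms] assms unfolding rho_cdf_def by auto
  then show ?thesis
    using emeasure_rho_t_Icc[OF assms] by (simp add: measure_def rho_cdf_def)
qed

lemma prob_space_rho_t:
  assumes "N \<ge> 2" "t \<in> {0..1}"
  shows "prob_space (rho_t N t)"
  using emeasure_rho_t_Icc[OF assms, of 1] assms by (intro prob_spaceI) (simp add: rho_cdf_def)

lemma prob_space_rho:
  assumes "N \<ge> 2"
  shows "prob_space (rho N)"
proof (rule prob_spaceI)
  let ?L = "ln (real N / (real N - 1))"
  let ?f = "\<lambda>x. inverse ?L * (1 / (x + real N - 1))"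
  have L: "?L > 0" using assms by (intro ln_gt_zero) (simp add: field_simps)
  have [measurable]: "?f \<in> borel_measurable borel" by measurable
  have "emeasure (rho N) (space (rho N)) =
      (\<integral>\<^sup>+x. ennreal (?f x) \<partial>restrict_space lborel {0..1})"
    unfolding rho_def
    by (subst emeasure_density)
       (auto simp: space_restrict_space sets_restrict_space intro!: nn_integral_cong measurable_restrict_space1)
  also have "\<dots> = (\<integral>\<^sup>+x. ennreal (?f x) * indicator {0..1} x \<partial>lborel)"
    by (subst nn_integral_restrict_space) auto
  also have "\<dots> = ennreal (inverse ?L * ln (1 + real N - 1) - inverse ?L * ln (0 + real N - 1))"
  proof (rule nn_integral_FTC_Icc[where F = "\<lambda>x. inverse ?L * ln (x + real N - 1)"])
    fix x :: real assume "x \<in> {0..1}"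
    then have x: "x + real N - 1 > 0" using assms by simp
    show "((\<lambda>x. inverse ?L * ln (x + real N - 1)) has_real_derivative ?f x) (at x)"
      by (rule derivative_eq_intros refl x | simp)+
    show "0 \<le> ?f x" using x L by (intro mult_nonneg_nonneg) auto
  qed auto
  also have "inverse ?L * ln (1 + real N - 1) - inverse ?L * ln (0 + real N - 1) = 1"
  proof -
    have "?L = ln (real N) - ln (real N - 1)" using assms by (simp add: ln_div)
    then have "ln (1 + real N - 1) - ln (0 + real N - 1) = ?L" by simp
    then show ?thesis using L by (simp only: right_diff_distrib[symmetric]) simp
  qed
  finally show "emeasure (rho N) (space (rho N)) = 1" by simp
qed

end

theory Submission
  imports Defs
begin

text \<open>
  Conditionally on the first digit being \<open>i\<close>, the shifted expansion under \<open>rho_t N t\<close> has law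
  \<open>rho_t N s\<close> with \<open>s = 1 - N / (i + t)\<close>. Iterating, the future after \<open>k\<close> digits is, given those
  digits, distributed according to some member of the same family; as each member is within a
  factor \<open>1 \<plusminus> eps N n\<close> of \<open>rho N\<close> on events depending on the digits from the \<open>n\<close>-th on, and \<open>rho N\<close> is
  invariant, this gives the bound for \<open>rho_t N t\<close>. Integrating it over \<open>t\<close> gives
  \<open>psi_mixing N (rho N) n \<le> eps N n\<close>, since \<open>rho N\<close> is the mixture of the \<open>rho_t N t\<close> with respect to
  \<open>rho N\<close> itself.

  Conversely, the parameter reached from any starting point through the digits
  \<open>d\<^sub>k, \<dots>, d\<^sub>1\<close> of \<open>t\<close> in reversed order converges to \<open>t\<close>, the inverse branches being
  contractions. So conditioning \<open>rho N\<close> on the corresponding cylinders recovers \<open>rho_t N t\<close>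
  in the limit. That the quotient in the theorem is meaningful rests on \<open>eps N n \<le> 1\<close>, a consequence
  of \<open>rho_t N t \<le> 2 rho N\<close>.
\<close>

section \<open>Setting: densities, inverse branches and weights\<close>

locale renyi_type_map =
  fixes N :: nat
  assumes N_ge_2: "N \<ge> 2"
begin

definition rho_dens :: "real \<Rightarrow> real" where
  "rho_dens x = inverse (ln (real N / (real N - 1))) * (1 / (x + real N - 1))"

definition rho_t_dens :: "real \<Rightarrow> real \<Rightarrow> real" where
  "rho_t_dens t x = real N * (real N - 1 + t) / (real N - (1 - x) * (1 - t))\<^sup>2"

text \<open>The inverse of the map on the points with first digit \<open>N + j\<close>; the digits are at least \<open>N\<close>.\<close>

definition branch :: "nat \<Rightarrow> real \<Rightarrow> real" where
  "branch j z = 1 - real N / (real N + real j + z)"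

definition branch_deriv :: "nat \<Rightarrow> real \<Rightarrow> real" where
  "branch_deriv j z = real N / (real N + real j + z)\<^sup>2"

text \<open>This is the probability under \<open>rho_t N t\<close> that the first digit is
  \<open>N + j\<close>. The companion of \<open>weight j t\<close> is \<open>branch j t\<close>: the
  maps \<open>branch j\<close> act on parameters as well as on points.\<close>

definition weight :: "nat \<Rightarrow> real \<Rightarrow> real" where
  "weight j t = (real N - 1 + t) / ((real N + real j - 1 + t) * (real N + real j + t))"

lemma ln_ratio_pos: "ln (real N / (real N - 1)) > 0"
  using N_ge_2 by (intro ln_gt_zero) (simp add: field_simps)

lemma denom_pos: "t \<in> {0..1} \<Longrightarrow> x \<in> {0..1} \<Longrightarrow> real N - (1 - x) * (1 - t) > 0"
  using rho_cdf_denom_pos[OF N_ge_2] by blast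

lemma rho_dens_nonneg: "x \<in> {0..1} \<Longrightarrow> 0 \<le> rho_dens x"
  using N_ge_2 ln_ratio_pos unfolding rho_dens_def by (intro mult_nonneg_nonneg) auto

lemma rho_t_dens_nonneg: "t \<in> {0..1} \<Longrightarrow> x \<in> {0..1} \<Longrightarrow> 0 \<le> rho_t_dens t x"
  using N_ge_2 unfolding rho_t_dens_def by simp

lemma weight_pos: "t \<in> {0..1} \<Longrightarrow> 0 < weight j t"
  using N_ge_2 unfolding weight_def by simp

lemma branch_deriv_nonneg: "0 \<le> branch_deriv j z"
  unfolding branch_deriv_def by simp

lemma branch_bounds:
  assumes "z \<in> {0..1}"
  shows "branch j z \<in> {0..1}"
  using assms N_ge_2 unfolding branch_def by (auto simp: field_simps)

lemma rho_dens_measurable [measurable]: "rho_dens \<in> borel_measurable borel"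
  unfolding rho_dens_def by measurable

lemma rho_t_dens_measurable [measurable]: "rho_t_dens t \<in> borel_measurable borel"
  unfolding rho_t_dens_def by measurable

lemma branch_measurable [measurable]: "branch j \<in> borel_measurable borel"
  unfolding branch_def by measurable

lemma branch_deriv_measurable [measurable]: "branch_deriv j \<in> borel_measurable borel"
  unfolding branch_deriv_def by measurable

section \<open>Both families of measures as Lebesgue densities\<close>

lemma has_real_derivative_rho_cdf:
  assumes "t \<in> {0..1}" "x \<in> {0..1}"
  shows "(rho_cdf N t has_real_derivative rho_t_dens t x) (at x)"
proof -
  have "((\<lambda>x. real N * x / (real N - (1 - x) * (1 - t))) has_real_derivative
     (real N * (real N - (1 - x) * (1 - t)) - real N * x * (1 - t)) / ((real N - (1 - x) * (1 - t)) * (real N - (1 - x) * (1 - t)))) (at x)"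
    by (rule derivative_eq_intros refl | use denom_pos[OF assms] in force)+
  moreover have "real N * (real N - (1 - x) * (1 - t)) - real N * x * (1 - t) = real N * (real N - 1 + t)"
    by (simp add: algebra_simps)
  ultimately show ?thesis
    unfolding rho_cdf_def[abs_def] rho_t_dens_def power2_eq_square by simp
qed

text \<open>Both sides are finite Borel measures on the line with the same distribution function.
  That of the right-hand side comes from the fundamental theorem of calculus on
  \<open>{0..min 1 x}\<close>.\<close>

lemma interval_measure_rho_cdf_eq_density:
  assumes t: "t \<in> {0..1}"
  shows "interval_measure (\<lambda>x. rho_cdf N t (max 0 (min 1 x)))
       = density lborel (\<lambda>x. ennreal (rho_t_dens t x) * indicator {0..1} x)"
    (is "interval_measure ?F = ?M")
proof -
  have mono: "?F a \<le> ?F b" if "a \<le> b" for a b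
    using that by (intro rho_cdf_mono[OF N_ge_2 t]) auto
  have d: "real N - (1 - max 0 (min 1 x)) * (1 - t) \<noteq> 0" for x
    using denom_pos[OF t, of "max 0 (min 1 x)"] by auto
  have "continuous_on UNIV ?F"
    unfolding rho_cdf_def by (intro continuous_intros ballI d)
  then have cont: "continuous (at_right a) ?F" for a
    by (simp add: continuous_on_eq_continuous_at continuous_at_imp_continuous_at_within)
  have "eventually (\<lambda>x. ?F x = 0) at_bot"
    using eventually_le_at_bot[of "0::real"] by eventually_elim (simp add: rho_cdf_def)
  then have bot: "(?F \<longlongrightarrow> 0) at_bot"
    by (rule tendsto_eventually)
  have "eventually (\<lambda>x. ?F x = 1) at_top"
    using eventually_ge_at_top[of "1::real"]
    by eventually_elim (use N_ge_2 in \<open>simp add: rho_cdf_def\<close>)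
  then have top: "(?F \<longlongrightarrow> 1) at_top"
    by (rule tendsto_eventually)
  interpret F: real_distribution "interval_measure ?F"
    by (rule real_distribution_interval_measure[OF mono cont bot top])
  have Iic: "emeasure ?M {..x} = ennreal (?F x)" for x
  proof -
    have "emeasure ?M {..x} = (\<integral>\<^sup>+y. ennreal (rho_t_dens t y) * indicator {0..min 1 x} y \<partial>lborel)"
      by (subst emeasure_density) (auto intro!: nn_integral_cong split: split_indicator)
    also have "\<dots> = ennreal (?F x)"
    proof (cases "x < 0")
      case True
      then have "{0..min 1 x} = {}" by auto
      with True show ?thesis by (simp add: rho_cdf_def)
    next
      case False
      have "(\<integral>\<^sup>+y. ennreal (rho_t_dens t y) * indicator {0..min 1 x} y \<partial>lborel)
          = ennreal (rho_cdf N t (min 1 x) - rho_cdf N t 0)"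
        using False t
        by (intro nn_integral_FTC_Icc)
           (auto intro!: has_real_derivative_rho_cdf rho_t_dens_nonneg)
      with False show ?thesis by (simp add: rho_cdf_def)
    qed
    finally show ?thesis .
  qed
  have "emeasure ?M UNIV = emeasure ?M {..1}"
    by (subst (1 2) emeasure_density) (auto intro!: nn_integral_cong split: split_indicator)
  then have "finite_measure ?M"
    by (intro finite_measureI) (simp add: Iic)
  then have M: "finite_borel_measure ?M"
    by (simp add: finite_borel_measure_def finite_borel_measure_axioms_def)
  show ?thesis
  proof (rule cdf_unique'[OF F.finite_borel_measure_M M], rule ext)
    fix x
    \<comment> \<open>\<open>?F\<close> vanishes at -1, so monotonicity gives the sign. It is needed
      because \<open>ennreal\<close> would send a negative value to 0.\<close>
    have "0 \<le> ?F x"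
      using mono[of "-1" x] mono[of x "-1"] by (cases "x \<le> -1") (auto simp: rho_cdf_def)
    then have "cdf ?M x = ?F x"
      by (simp add: cdf_def measure_def Iic)
    then show "cdf (interval_measure ?F) x = cdf ?M x"
      by (simp add: cdf_interval_measure[OF mono cont bot])
  qed
qed

lemma emeasure_rho_t:
  assumes t: "t \<in> {0..1}" and A: "A \<in> sets borel" "A \<subseteq> {0..1}"
  shows "emeasure (rho_t N t) A = (\<integral>\<^sup>+x. ennreal (rho_t_dens t x) * indicator A x \<partial>lborel)"
proof -
  have "emeasure (rho_t N t) A = emeasure (density lborel (\<lambda>x. ennreal (rho_t_dens t x) * indicator {0..1} x)) A"
    unfolding rho_t_def interval_measure_rho_cdf_eq_density[OF t] using A by (subst emeasure_restrict_space) auto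
  also have "\<dots> = (\<integral>\<^sup>+x. ennreal (rho_t_dens t x) * indicator A x \<partial>lborel)"
    using A by (subst emeasure_density) (auto intro!: nn_integral_cong split: split_indicator)
  finally show ?thesis .
qed

lemma emeasure_rho:
  assumes A: "A \<in> sets borel" "A \<subseteq> {0..1}"
  shows "emeasure (rho N) A = (\<integral>\<^sup>+x. ennreal (rho_dens x) * indicator A x \<partial>lborel)"
proof -
  have "emeasure (rho N) A = (\<integral>\<^sup>+x. ennreal (rho_dens x) * indicator A x \<partial>restrict_space lborel {0..1})"
    unfolding rho_def rho_dens_def using A
    by (subst emeasure_density) (auto simp: sets_restrict_space_iff intro!: measurable_restrict_space1)
  also have "\<dots> = (\<integral>\<^sup>+x. ennreal (rho_dens x) * indicator A x * indicator {0..1} x \<partial>lborel)"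
    using A by (subst nn_integral_restrict_space) auto
  also have "\<dots> = (\<integral>\<^sup>+x. ennreal (rho_dens x) * indicator A x \<partial>lborel)"
    using A by (auto intro!: nn_integral_cong split: split_indicator)
  finally show ?thesis .
qed

lemma nn_integral_rho:
  assumes [measurable]: "f \<in> borel_measurable borel"
  shows "(\<integral>\<^sup>+x. f x \<partial>rho N) = (\<integral>\<^sup>+x. ennreal (rho_dens x) * f x * indicator {0..1} x \<partial>lborel)"
proof -
  have "(\<integral>\<^sup>+x. f x \<partial>rho N) = (\<integral>\<^sup>+x. ennreal (rho_dens x) * f x \<partial>restrict_space lborel {0..1})"
    unfolding rho_def rho_dens_def
    by (subst nn_integral_density) (auto intro!: measurable_restrict_space1)
  then show ?thesis
    by (subst (asm) nn_integral_restrict_space) auto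
qed

subsection \<open>Inverse branches\<close>

lemma has_real_derivative_branch:
  assumes "z \<in> {0..1}"
  shows "(branch j has_real_derivative branch_deriv j z) (at z)"
  unfolding branch_def[abs_def] branch_deriv_def
  by (rule derivative_eq_intros refl | use assms N_ge_2 in \<open>force simp: power2_eq_square\<close>)+

text \<open>The endpoint 1 is left out because \<open>branch j 1 = branch (Suc j) 0\<close> already
  has the next digit. Only on \<open>{0..<1}\<close> does \<open>branch j\<close> produce the digit
  \<open>N + j\<close>.\<close>

definition pull :: "nat \<Rightarrow> real set \<Rightarrow> real set" where
  "pull j A = {z \<in> {0..<1}. branch j z \<in> A}"

text \<open>Everything follows from \<open>N / (1 - branch j z) = N + j + z\<close>: for
  \<open>z < 1\<close> the integer part is \<open>N + j\<close> and the fractional part is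
  \<open>z\<close>.\<close>

lemma floor_branch:
  assumes "z \<in> {0..<1}"
  shows "branch j z \<noteq> 1" "\<lfloor>real N / (1 - branch j z)\<rfloor> = int (N + j)" "renyi N (branch j z) = z"
proof -
  have *: "real N / (1 - branch j z) = real N + real j + z"
    using assms N_ge_2 by (simp add: branch_def)
  show 1: "branch j z \<noteq> 1"
    using assms N_ge_2 by (simp add: branch_def)
  show 2: "\<lfloor>real N / (1 - branch j z)\<rfloor> = int (N + j)"
    unfolding * using assms by (simp add: floor_eq_iff)
  show "renyi N (branch j z) = z"
    using 1 2 unfolding renyi_def * by simp
qed

lemma branch_surj:
  assumes "x \<in> {0..<1}"
  obtains j where "renyi N x \<in> {0..<1}" "x = branch j (renyi N x)"
proof -
  let ?y = "real N / (1 - x)"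
  have y: "?y \<ge> real N" using assms by (simp add: field_simps)
  then have fl: "int N \<le> \<lfloor>?y\<rfloor>" by (simp add: le_floor_iff)
  define j where "j = nat (\<lfloor>?y\<rfloor> - int N)"
  have j: "real_of_int \<lfloor>?y\<rfloor> = real N + real j"
    unfolding j_def using fl by simp
  have R: "renyi N x = ?y - (real N + real j)"
    using assms j by (simp add: renyi_def)
  have "renyi N x \<in> {0..<1}"
    unfolding R j[symmetric] atLeastLessThan_iff by linarith
  moreover have "x = branch j (renyi N x)"
    unfolding branch_def R using assms N_ge_2 by simp
  ultimately show ?thesis using that by blast
qed

lemma renyi_range: "x \<in> {0..1} \<Longrightarrow> renyi N x \<in> {0..<1}"
  by (cases "x = 1") (simp_all add: renyi_def, linarith)

text \<open>The intervals from \<open>branch j 0\<close> to \<open>branch j 1\<close> are adjacent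
  and tile \<open>{0..<1}\<close>. On each of them \<open>branch j\<close> is substituted; the
  substitution rule wants closed intervals, and the endpoints added for it are null sets.\<close>

lemma nn_integral_branches:
  fixes f :: "real \<Rightarrow> real"
  assumes [measurable]: "f \<in> borel_measurable borel" "A \<in> sets borel" and A: "A \<subseteq> {0..1}"
  shows "(\<integral>\<^sup>+x. ennreal (f x) * indicator A x \<partial>lborel) =
    (\<Sum>j. \<integral>\<^sup>+z. ennreal (f (branch j z) * branch_deriv j z) * indicator (pull j A) z \<partial>lborel)"
proof -
  let ?I = "\<lambda>j. {branch j 0..<branch j 1}"
  have step: "branch (Suc j) 0 = branch j 1" for j
    by (simp add: branch_def algebra_simps)
  have branch_mono: "branch i 0 \<le> branch j 0" if "i \<le> j" for i j
    unfolding branch_def using that N_ge_2 by (simp add: frac_le)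
  have disj: "disjoint_family (\<lambda>j. A \<inter> ?I j)"
  proof -
    have "?I i \<inter> ?I j = {}" if "i < j" for i j
      using branch_mono[of "Suc i" j] that by (auto simp: step)
    then have "(A \<inter> ?I i) \<inter> (A \<inter> ?I j) = {}" if "i \<noteq> j" for i j
      using that by (metis Int_assoc Int_commute Int_empty_right linorder_neqE_nat)
    then show ?thesis unfolding disjoint_family_on_def by blast
  qed
  have in_I: "branch j z \<in> ?I j" if "z \<in> {0..<1}" for j z
    using that N_ge_2 by (auto simp: branch_def intro!: divide_left_mono divide_strict_left_mono)
  \<comment> \<open>The point 1, whose first digit is infinite, lies in no branch interval; it is
    discarded as a null set.\<close>
  have un: "(\<Union>j. A \<inter> ?I j) = A - {1}"
  proof -
    have "x \<in> (\<Union>j. ?I j)" if "x \<in> {0..<1}" for x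
      using branch_surj[OF that] in_I by (metis UNIV_I UN_I)
    moreover have "branch j 1 \<le> 1" for j
      by (simp add: branch_def)
    ultimately show ?thesis
    proof (intro equalityI subsetI)
      fix x assume "x \<in> A - {1}"
      with A have "x \<in> {0..<1}" by (auto simp: less_le)
      with \<open>x \<in> A - {1}\<close> show "x \<in> (\<Union>j. A \<inter> ?I j)"
        using \<open>\<And>x. x \<in> {0..<1} \<Longrightarrow> x \<in> (\<Union>j. ?I j)\<close> by blast
    next
      fix x assume "x \<in> (\<Union>j. A \<inter> ?I j)"
      then obtain j where "x \<in> A" "x < branch j 1" by auto
      with \<open>\<And>j. branch j 1 \<le> 1\<close>[of j] show "x \<in> A - {1}" by auto
    qed
  qed
  have "(\<integral>\<^sup>+x. ennreal (f x) * indicator A x \<partial>lborel) = (\<integral>\<^sup>+x. ennreal (f x) * indicator (A - {1}) x \<partial>lborel)"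
    by (rule nn_integral_cong_AE) (use AE_lborel_singleton[of 1] in eventually_elim, auto split: split_indicator)
  also have "\<dots> = emeasure (density lborel (\<lambda>x. ennreal (f x))) (A - {1})"
    by (subst emeasure_density) auto
  also have "\<dots> = (\<Sum>j. emeasure (density lborel (\<lambda>x. ennreal (f x))) (A \<inter> ?I j))"
    unfolding un[symmetric] by (rule suminf_emeasure[symmetric]) (use disj in auto)
  also have "\<dots> = (\<Sum>j. \<integral>\<^sup>+z. ennreal (f (branch j z) * branch_deriv j z) * indicator (pull j A) z \<partial>lborel)"
  proof (rule suminf_cong)
    fix j
    have "emeasure (density lborel (\<lambda>x. ennreal (f x))) (A \<inter> ?I j)
        = (\<integral>\<^sup>+x. ennreal (f x) * indicator (A \<inter> ?I j) x \<partial>lborel)"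
      by (subst emeasure_density) auto
    also have "\<dots> = (\<integral>\<^sup>+x. ennreal (f x * indicator A x * indicator {branch j 0..branch j 1} x) \<partial>lborel)"
      by (rule nn_integral_cong_AE)
         (use AE_lborel_singleton[of "branch j 1"] in eventually_elim, auto split: split_indicator)
    also have "\<dots> = (\<integral>\<^sup>+z. ennreal (f (branch j z) * indicator A (branch j z) * branch_deriv j z * indicator {0..1} z) \<partial>lborel)"
      using N_ge_2
      by (intro nn_integral_substitution)
         (auto simp: set_borel_measurable_def branch_deriv_nonneg branch_deriv_def[abs_def]
            intro!: has_real_derivative_branch[unfolded branch_deriv_def] continuous_intros)
    also have "\<dots> = (\<integral>\<^sup>+z. ennreal (f (branch j z) * branch_deriv j z) * indicator (pull j A) z \<partial>lborel)"
      by (rule nn_integral_cong_AE)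
         (use AE_lborel_singleton[of 1] in eventually_elim, auto simp: pull_def split: split_indicator)
    finally show "emeasure (density lborel (\<lambda>x. ennreal (f x))) (A \<inter> ?I j) = \<dots>" .
  qed
  finally show ?thesis .
qed

section \<open>Splitting \<open>rho_t\<close> by the first digit\<close>

lemma pull_measurable [measurable]:
  assumes [measurable]: "A \<in> sets borel"
  shows "pull j A \<in> sets borel"
  unfolding pull_def by measurable

lemma pull_subset: "pull j A \<subseteq> {0..1}"
  by (auto simp: pull_def)

text \<open>This identity keeps the family closed under conditioning on a digit. With
  \<open>a = N + j\<close>, moving the branch from the point to the parameter leaves the factor
  \<open>a + z - 1 + t\<close> of the denominator intact and only replaces the divisor
  \<open>a + z\<close> by \<open>a + t\<close>.\<close>

lemma rho_t_dens_branch: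
  assumes "t \<in> {0..1}" "z \<in> {0..1}"
  shows "rho_t_dens t (branch j z) * branch_deriv j z = weight j t * rho_t_dens (branch j t) z"
proof -
  define n where "n = real N"
  define a where "a = n + real j"
  have br: "branch j y = 1 - n / (a + y)" for y
    by (simp add: branch_def a_def n_def)
  have pos: "n > 0" "a + z > 0" "a + t > 0" "a - 1 + t > 0" "a + z - 1 + t > 0"
    using assms N_ge_2 by (auto simp: a_def n_def)
  have 1: "n - (1 - branch j z) * (1 - t) = n * (a + z - 1 + t) / (a + z)"
    and 2: "n - (1 - z) * (1 - branch j t) = n * (a + z - 1 + t) / (a + t)"
    and 3: "n - 1 + branch j t = n * (a - 1 + t) / (a + t)"
    using pos by (auto simp: br field_simps)
  have "n * m / (n * E / y)\<^sup>2 * (n / y\<^sup>2) = m / E\<^sup>2" if "E > 0" "y > 0" for m E y :: real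
    using that pos(1) by (simp add: power2_eq_square field_simps)
  from this[of "a + z - 1 + t" "a + z" "n - 1 + t"] pos
  have "rho_t_dens t (branch j z) * branch_deriv j z = (n - 1 + t) / (a + z - 1 + t)\<^sup>2"
    unfolding rho_t_dens_def branch_deriv_def n_def[symmetric] a_def[symmetric] 1 by simp
  moreover have "weight j t * rho_t_dens (branch j t) z = (n - 1 + t) / (a + z - 1 + t)\<^sup>2"
    unfolding rho_t_dens_def weight_def n_def[symmetric] a_def[symmetric] 2 3
    using pos by (simp add: power_divide power_mult_distrib) (simp add: power2_eq_square)
  ultimately show ?thesis by simp
qed

text \<open>The summand with index \<open>j\<close> is the mass of the part of \<open>A\<close> with
  first digit \<open>N + j\<close>. Given that digit, the shifted point has law
  \<open>rho_t N (branch j t)\<close>.\<close>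

lemma emeasure_rho_t_branches:
  assumes t: "t \<in> {0..1}" and [measurable]: "A \<in> sets borel" and A: "A \<subseteq> {0..1}"
  shows "emeasure (rho_t N t) A = (\<Sum>j. ennreal (weight j t) * emeasure (rho_t N (branch j t)) (pull j A))"
proof -
  have "emeasure (rho_t N t) A =
      (\<Sum>j. \<integral>\<^sup>+z. ennreal (rho_t_dens t (branch j z) * branch_deriv j z) * indicator (pull j A) z \<partial>lborel)"
    using t A by (subst emeasure_rho_t) (auto intro!: nn_integral_branches)
  also have "\<dots> = (\<Sum>j. ennreal (weight j t) * emeasure (rho_t N (branch j t)) (pull j A))"
  proof (rule suminf_cong)
    fix j
    have "(\<integral>\<^sup>+z. ennreal (rho_t_dens t (branch j z) * branch_deriv j z) * indicator (pull j A) z \<partial>lborel)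
        = (\<integral>\<^sup>+z. ennreal (weight j t) * (ennreal (rho_t_dens (branch j t) z) * indicator (pull j A) z) \<partial>lborel)"
    proof (rule nn_integral_cong)
      fix z :: real
      show "ennreal (rho_t_dens t (branch j z) * branch_deriv j z) * indicator (pull j A) z
        = ennreal (weight j t) * (ennreal (rho_t_dens (branch j t) z) * indicator (pull j A) z)"
      proof (cases "z \<in> pull j A")
        case True
        with pull_subset have z: "z \<in> {0..1}" by blast
        have "0 \<le> rho_t_dens (branch j t) z"
          by (rule rho_t_dens_nonneg[OF branch_bounds[OF t] z])
        then show ?thesis
          using weight_pos[OF t, of j] True by (simp add: rho_t_dens_branch[OF t z] ennreal_mult)
      qed simp
    qed
    also have "\<dots> = ennreal (weight j t) * emeasure (rho_t N (branch j t)) (pull j A)"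
      by (subst nn_integral_cmult)
         (auto simp: emeasure_rho_t[OF branch_bounds[OF t] _ pull_subset])
    finally show "(\<integral>\<^sup>+z. ennreal (rho_t_dens t (branch j z) * branch_deriv j z) * indicator (pull j A) z \<partial>lborel) = \<dots>" .
  qed
  finally show ?thesis .
qed

lemma emeasure_rho_t_diff_1:
  assumes "t \<in> {0..1}" "A \<in> sets borel" "A \<subseteq> {0..1}"
  shows "emeasure (rho_t N t) (A \<inter> {0..<1}) = emeasure (rho_t N t) A"
proof -
  have "A \<inter> {0..<1} \<in> sets borel" "A \<inter> {0..<1} \<subseteq> {0..1}" using assms by auto
  with assms show ?thesis
    by (simp only: emeasure_rho_t)
       (rule nn_integral_cong_AE, use AE_lborel_singleton[of 1] in eventually_elim, auto split: split_indicator)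
qed

lemma emeasure_rho_diff_1:
  assumes "A \<in> sets borel" "A \<subseteq> {0..1}"
  shows "emeasure (rho N) (A \<inter> {0..<1}) = emeasure (rho N) A"
proof -
  have "A \<inter> {0..<1} \<in> sets borel" "A \<inter> {0..<1} \<subseteq> {0..1}" using assms by auto
  with assms show ?thesis
    by (simp only: emeasure_rho)
       (rule nn_integral_cong_AE, use AE_lborel_singleton[of 1] in eventually_elim, auto split: split_indicator)
qed

lemma renyi_measurable [measurable]: "renyi N \<in> borel_measurable borel"
  unfolding renyi_def by measurable

lemma renyi_funpow_measurable [measurable]: "(renyi N ^^ k) \<in> borel_measurable borel"
  by (induction k) (auto intro: measurable_compose simp: comp_def)

subsection \<open>Invariance, mixture and domination\<close>

text \<open>The fixed point equation of the transfer operator of \<open>renyi N\<close>. With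
  \<open>a = N + j + z\<close>, partial fractions turn each term into
  \<open>c / (a - 1) - c / a\<close>, and the series telescopes.\<close>

lemma rho_dens_branch_sums:
  assumes z: "z \<in> {0..1}"
  shows "(\<lambda>j. rho_dens (branch j z) * branch_deriv j z) sums rho_dens z"
proof -
  define c where "c = inverse (ln (real N / (real N - 1)))"
  define u where "u j = c / (real N + real j - 1 + z)" for j
  have eq: "rho_dens (branch j z) * branch_deriv j z = u j - u (Suc j)" for j
  proof -
    define n where "n = real N"
    define a where "a = n + real j + z"
    have br: "branch j z = 1 - n / a"
      by (simp add: branch_def a_def n_def)
    have pos: "n > 0" "a > 1" using z N_ge_2 by (auto simp: a_def n_def)
    have "branch j z + n - 1 = n * (a - 1) / a"
      using pos by (simp add: br field_simps)
    then have "rho_dens (branch j z) * branch_deriv j z = c * (1 / (n * (a - 1) / a)) * (n / a\<^sup>2)"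
      by (simp add: rho_dens_def branch_deriv_def c_def a_def n_def)
    also have "\<dots> = c / (a - 1) - c / a"
      using pos by (simp add: power2_eq_square field_simps)
    finally show ?thesis by (simp add: u_def a_def n_def algebra_simps)
  qed
  have "u \<longlonglongrightarrow> 0"
  proof -
    have "filterlim (\<lambda>j. (real N - 1 + z) + real j) at_top sequentially"
      by (intro filterlim_tendsto_add_at_top[OF tendsto_const] filterlim_real_sequentially)
    then have "(\<lambda>j. c / ((real N - 1 + z) + real j)) \<longlonglongrightarrow> 0"
      by (intro tendsto_divide_0[OF tendsto_const] filterlim_at_top_imp_at_infinity)
    then show ?thesis by (simp add: u_def[abs_def] algebra_simps)
  qed
  then have "(\<lambda>j. u j - u (Suc j)) sums (u 0 - 0)"
    by (rule telescope_sums')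
  moreover have "u 0 = rho_dens z"
    by (simp add: u_def rho_dens_def c_def algebra_simps)
  ultimately show ?thesis by (simp add: eq)
qed

text \<open>Seen through any branch, the preimage of \<open>C\<close> is \<open>C\<close> itself up
  to the point 1. All summands therefore share one indicator, and the sum over the branches can be
  taken under the integral.\<close>

lemma rho_invariant:
  assumes [measurable]: "C \<in> sets borel" and C: "C \<subseteq> {0..1}"
  shows "emeasure (rho N) (renyi N -` C \<inter> {0..1}) = emeasure (rho N) C"
proof -
  have pull: "pull j (renyi N -` C \<inter> {0..1}) = C \<inter> {0..<1}" for j
    using C floor_branch(3) branch_bounds by (fastforce simp: pull_def)
  have "renyi N -` C \<inter> {0..1} \<in> sets borel"
    by measurable
  then have "emeasure (rho N) (renyi N -` C \<inter> {0..1}) =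
      (\<Sum>j. \<integral>\<^sup>+z. ennreal (rho_dens (branch j z) * branch_deriv j z) * indicator (C \<inter> {0..<1}) z \<partial>lborel)"
    by (subst emeasure_rho) (auto simp: nn_integral_branches pull)
  also have "\<dots> = (\<integral>\<^sup>+z. (\<Sum>j. ennreal (rho_dens (branch j z) * branch_deriv j z) * indicator (C \<inter> {0..<1}) z) \<partial>lborel)"
    by (rule nn_integral_suminf[symmetric]) measurable
  also have "\<dots> = (\<integral>\<^sup>+z. ennreal (rho_dens z) * indicator (C \<inter> {0..<1}) z \<partial>lborel)"
  proof (rule nn_integral_cong)
    fix z :: real
    show "(\<Sum>j. ennreal (rho_dens (branch j z) * branch_deriv j z) * indicator (C \<inter> {0..<1}) z)
        = ennreal (rho_dens z) * indicator (C \<inter> {0..<1}) z"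
    proof (cases "z \<in> C \<inter> {0..<1}")
      case True
      then have z: "z \<in> {0..1}" by auto
      have "0 \<le> rho_dens (branch j z) * branch_deriv j z" for j
        using rho_dens_nonneg[OF branch_bounds[OF z]] branch_deriv_nonneg by simp
      with True show ?thesis
        using rho_dens_branch_sums[OF z]
        by (simp add: suminf_ennreal_eq sums_iff)
    qed simp
  qed
  also have "\<dots> = emeasure (rho N) (C \<inter> {0..<1})"
    by (subst emeasure_rho) auto
  finally show ?thesis
    using C by (simp add: emeasure_rho_diff_1)
qed

lemma rho_invariant_funpow:
  assumes "C \<in> sets borel" "C \<subseteq> {0..1}"
  shows "emeasure (rho N) ((renyi N ^^ k) -` C \<inter> {0..1}) = emeasure (rho N) C"
proof (induction k)
  case 0
  then show ?case using assms by (simp add: Int_absorb2)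
next
  case (Suc k)
  have "(renyi N ^^ Suc k) -` C \<inter> {0..1}
      = renyi N -` ((renyi N ^^ k) -` C \<inter> {0..1}) \<inter> {0..1}"
    using renyi_range by (force simp: funpow_swap1)
  moreover have "(renyi N ^^ k) -` C \<in> sets borel"
    using measurable_sets[OF renyi_funpow_measurable assms(1)] by simp
  moreover from this have "emeasure (rho N) (renyi N -` ((renyi N ^^ k) -` C \<inter> {0..1}) \<inter> {0..1})
      = emeasure (rho N) ((renyi N ^^ k) -` C \<inter> {0..1})"
    by (intro rho_invariant) auto
  ultimately show ?case
    using Suc by (simp only:)
qed

text \<open>\<open>rho_dens\<close> is stationary for the kernel \<open>rho_t_dens\<close>. The
  factor \<open>t + N - 1\<close> cancels in the product, leaving a constant over the square of a
  function affine in \<open>t\<close>, which has an elementary antiderivative.\<close>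

lemma nn_integral_rho_dens_kernel:
  assumes x: "x \<in> {0..1}"
  shows "(\<integral>\<^sup>+t. ennreal (rho_dens t * rho_t_dens t x) * indicator {0..1} t \<partial>lborel) = ennreal (rho_dens x)"
proof -
  define n where "n = real N"
  define c where "c = inverse (ln (n / (n - 1)))"
  define q where "q = 1 - x"
  \<comment> \<open>This antiderivative remains valid at \<open>q = 0\<close>, unlike the more
    obvious one with \<open>q\<close> in the denominator.\<close>
  define F where "F t = c * n / (n - q) * (t / (n - q * (1 - t)))" for t
  have pos: "n \<ge> 2" "0 \<le> q" "q \<le> 1" using x N_ge_2 by (auto simp: n_def q_def)
  have "(\<integral>\<^sup>+t. ennreal (rho_dens t * rho_t_dens t x) * indicator {0..1} t \<partial>lborel) = ennreal (F 1 - F 0)"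
  proof (rule nn_integral_FTC_Icc)
    show "(\<lambda>t. rho_dens t * rho_t_dens t x) \<in> borel_measurable borel"
      unfolding rho_t_dens_def by measurable
    fix t :: real assume t: "t \<in> {0..1}"
    show "0 \<le> rho_dens t * rho_t_dens t x"
      using rho_dens_nonneg[OF t] rho_t_dens_nonneg[OF t x] by simp
    have D: "n - q * (1 - t) > 0" using denom_pos[OF t x] by (simp add: n_def q_def)
    have "((\<lambda>t. t / (n - q * (1 - t))) has_real_derivative
        (1 * (n - q * (1 - t)) - t * q) / ((n - q * (1 - t)) * (n - q * (1 - t)))) (at t)"
      by (rule derivative_eq_intros refl | use D in force)+
    then have "(F has_real_derivative c * n / (n - q) *
        ((1 * (n - q * (1 - t)) - t * q) / ((n - q * (1 - t)) * (n - q * (1 - t))))) (at t)"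
      unfolding F_def[abs_def] by (rule DERIV_cmult)
    moreover have "1 * (n - q * (1 - t)) - t * q = n - q"
      by (simp add: algebra_simps)
    moreover have "c * n / (n - q) * ((n - q) / ((n - q * (1 - t)) * (n - q * (1 - t))))
        = rho_dens t * rho_t_dens t x"
    proof -
      have *: "t + n - 1 \<noteq> 0" "n - 1 + t = t + n - 1" using t pos by auto
      show ?thesis
        using *(1) pos unfolding rho_dens_def rho_t_dens_def n_def[symmetric] c_def[symmetric] q_def[symmetric] *(2)
        by (simp add: power2_eq_square)
    qed
    ultimately show "(F has_real_derivative rho_dens t * rho_t_dens t x) (at t)" by (simp only:)
  qed auto
  also have "F 1 - F 0 = rho_dens x"
    using pos by (simp add: F_def rho_dens_def c_def n_def q_def algebra_simps)
  finally show ?thesis .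
qed

lemma emeasure_rho_t_measurable:
  assumes A: "A \<in> sets borel" "A \<subseteq> {0..1}"
  shows "(\<lambda>t. emeasure (rho_t N t) A) \<in> borel_measurable (rho N)"
proof -
  have "(\<lambda>t. \<integral>\<^sup>+x. ennreal (rho_t_dens t x) * indicator A x \<partial>lborel) \<in> borel_measurable borel"
    using A unfolding rho_t_dens_def by measurable
  then have "(\<lambda>t. \<integral>\<^sup>+x. ennreal (rho_t_dens t x) * indicator A x \<partial>lborel) \<in> borel_measurable (rho N)"
    by (simp add: measurable_restrict_space1 cong: measurable_cong_sets)
  then show ?thesis
    by (subst measurable_cong) (simp_all add: emeasure_rho_t A)
qed

text \<open>Tonelli's theorem reduces the claim to the stationarity of \<open>rho_dens\<close>. The
  formula transfers inequalities that hold for every \<open>rho_t N t\<close> to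
  \<open>rho N\<close>.\<close>

lemma rho_mixture:
  assumes [measurable]: "A \<in> sets borel" and A: "A \<subseteq> {0..1}"
  shows "emeasure (rho N) A = (\<integral>\<^sup>+t. emeasure (rho_t N t) A \<partial>rho N)"
proof -
  have [measurable]: "(\<lambda>(t, x). ennreal (rho_dens t * rho_t_dens t x)) \<in> borel_measurable (borel \<Otimes>\<^sub>M borel)"
    unfolding rho_t_dens_def by measurable
  have [measurable]: "(\<lambda>t. \<integral>\<^sup>+x. ennreal (rho_t_dens t x) * indicator A x \<partial>lborel) \<in> borel_measurable borel"
    unfolding rho_t_dens_def by measurable
  have "(\<integral>\<^sup>+t. emeasure (rho_t N t) A \<partial>rho N)
      = (\<integral>\<^sup>+t. (\<integral>\<^sup>+x. ennreal (rho_t_dens t x) * indicator A x \<partial>lborel) \<partial>rho N)"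
    using A by (intro nn_integral_cong) (simp add: emeasure_rho_t)
  also have "\<dots> = (\<integral>\<^sup>+t. ennreal (rho_dens t) * (\<integral>\<^sup>+x. ennreal (rho_t_dens t x) * indicator A x \<partial>lborel) * indicator {0..1} t \<partial>lborel)"
    by (rule nn_integral_rho) measurable
  also have "\<dots> = (\<integral>\<^sup>+t. (\<integral>\<^sup>+x. ennreal (rho_dens t * rho_t_dens t x) * indicator A x * indicator {0..1} t \<partial>lborel) \<partial>lborel)"
  proof (rule nn_integral_cong)
    fix t :: real
    show "ennreal (rho_dens t) * (\<integral>\<^sup>+x. ennreal (rho_t_dens t x) * indicator A x \<partial>lborel) * indicator {0..1} t
       = (\<integral>\<^sup>+x. ennreal (rho_dens t * rho_t_dens t x) * indicator A x * indicator {0..1} t \<partial>lborel)"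
    proof (cases "t \<in> {0..1}")
      case True
      have "(\<integral>\<^sup>+x. ennreal (rho_dens t * rho_t_dens t x) * indicator A x \<partial>lborel)
          = (\<integral>\<^sup>+x. ennreal (rho_dens t) * (ennreal (rho_t_dens t x) * indicator A x) \<partial>lborel)"
        using A True rho_dens_nonneg[OF True] rho_t_dens_nonneg[OF True]
        by (intro nn_integral_cong) (auto split: split_indicator simp: ennreal_mult)
      also have "\<dots> = ennreal (rho_dens t) * (\<integral>\<^sup>+x. ennreal (rho_t_dens t x) * indicator A x \<partial>lborel)"
        by (rule nn_integral_cmult) measurable
      finally show ?thesis using True by simp
    qed simp
  qed
  also have "\<dots> = (\<integral>\<^sup>+x. (\<integral>\<^sup>+t. ennreal (rho_dens t * rho_t_dens t x) * indicator A x * indicator {0..1} t \<partial>lborel) \<partial>lborel)"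
    by (rule lborel_pair.Fubini'[symmetric]) measurable
  also have "\<dots> = (\<integral>\<^sup>+x. ennreal (rho_dens x) * indicator A x \<partial>lborel)"
    using A nn_integral_rho_dens_kernel by (intro nn_integral_cong) (auto split: split_indicator)
  also have "\<dots> = emeasure (rho N) A"
    using A by (simp add: emeasure_rho)
  finally show ?thesis by simp
qed

text \<open>The constant 2 bounds \<open>n * L\<close>: since \<open>ln u \<le> u - 1\<close>, this
  product is at most \<open>n / (n - 1)\<close>, which is at most 2 for \<open>n \<ge> 2\<close>.
  The remaining factors are absorbed by the square of the denominator \<open>D\<close>.\<close>

lemma rho_t_dens_le: "t \<in> {0..1} \<Longrightarrow> x \<in> {0..1} \<Longrightarrow> rho_t_dens t x \<le> 2 * rho_dens x"
proof -
  assume t: "t \<in> {0..1}" and x: "x \<in> {0..1}"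
  define n where "n = real N"
  define L where "L = ln (n / (n - 1))"
  define D where "D = n - (1 - x) * (1 - t)"
  have n: "n \<ge> 2" using N_ge_2 by (simp add: n_def)
  have L: "L > 0" using ln_ratio_pos by (simp add: L_def n_def)
  have "L \<le> n / (n - 1) - 1"
    unfolding L_def using n by (intro ln_le_minus_one) auto
  also have "\<dots> = 1 / (n - 1)" using n by (simp add: field_simps)
  finally have "n * L \<le> n * (1 / (n - 1))" using n by (intro mult_left_mono) auto
  also have "\<dots> \<le> 2" using n by (simp add: field_simps)
  finally have nL: "n * L \<le> 2" .
  \<comment> \<open>\<open>D\<close> dominates each of \<open>n - 1 + t\<close> and
    \<open>n - 1 + x\<close>, so its square dominates their product.\<close>
  have "(1 - x) * (1 - t) \<le> 1 - t" "(1 - x) * (1 - t) \<le> 1 - x"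
    using t x by (auto intro: mult_left_le_one_le mult_right_le_one_le)
  then have "n - 1 + t \<le> D" "n - 1 + x \<le> D" by (auto simp: D_def)
  then have le: "(n - 1 + t) * (n - 1 + x) \<le> D * D"
    using t x n by (intro mult_mono) auto
  have D: "D > 0" using denom_pos[OF t x] by (simp add: D_def n_def)
  have "n * L * ((n - 1 + t) * (n - 1 + x)) \<le> 2 * (D * D)"
    using t x n by (intro mult_mono[OF nL le]) auto
  then have "n * (n - 1 + t) * (L * (n - 1 + x)) \<le> 2 * (D * D)"
    by (simp only: ac_simps)
  moreover have "a / D\<^sup>2 \<le> 2 / m" if "a * m \<le> 2 * (D * D)" "m > 0" for a m
    using that D by (simp add: field_simps power2_eq_square)
  ultimately have "n * (n - 1 + t) / D\<^sup>2 \<le> 2 / (L * (n - 1 + x))"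
    using L n x by simp
  moreover have "rho_t_dens t x = n * (n - 1 + t) / D\<^sup>2"
    by (simp add: rho_t_dens_def n_def D_def)
  moreover have "2 * rho_dens x = 2 / (L * (n - 1 + x))"
    by (simp add: rho_dens_def n_def L_def field_simps)
  ultimately show ?thesis by simp
qed

lemma emeasure_rho_t_le:
  assumes t: "t \<in> {0..1}" and [measurable]: "A \<in> sets borel" and A: "A \<subseteq> {0..1}"
  shows "emeasure (rho_t N t) A \<le> 2 * emeasure (rho N) A"
proof -
  have "(\<integral>\<^sup>+x. ennreal (rho_t_dens t x) * indicator A x \<partial>lborel)
      \<le> (\<integral>\<^sup>+x. ennreal 2 * (ennreal (rho_dens x) * indicator A x) \<partial>lborel)"
    using A rho_t_dens_le[OF t] rho_dens_nonneg
    by (intro nn_integral_mono) (auto split: split_indicator simp: ennreal_mult[symmetric] simp del: ennreal_numeral)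
  also have "\<dots> = ennreal 2 * (\<integral>\<^sup>+x. ennreal (rho_dens x) * indicator A x \<partial>lborel)"
    by (rule nn_integral_cmult) measurable
  finally show ?thesis
    using t A by (simp add: emeasure_rho_t emeasure_rho)
qed

subsection \<open>Digit algebras\<close>

lemma digit_measurable [measurable]: "digit N i \<in> borel \<rightarrow>\<^sub>M count_space UNIV"
proof -
  have [measurable]: "(\<lambda>x. enat (nat \<lfloor>real N / (1 - x)\<rfloor>)) \<in> borel \<rightarrow>\<^sub>M count_space UNIV"
    by (rule measurable_compose[of _ _ "count_space UNIV"]) measurable
  have "digit1 N \<in> borel \<rightarrow>\<^sub>M count_space UNIV"
    unfolding digit1_def by measurable
  then show ?thesis
    unfolding digit_def by (rule measurable_compose[OF renyi_funpow_measurable])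
qed

lemma digit_algebra_borel:
  assumes "A \<in> digit_algebra N J"
  shows "A \<in> sets borel" "A \<subseteq> {0..1}"
proof -
  have "A \<in> sets borel \<and> A \<subseteq> {0..1}"
    using assms unfolding digit_algebra_def
  proof (induction rule: sigma_sets.induct)
    case (Basic a)
    then obtain i S where a: "a = digit N i -` S \<inter> {0..1}" by blast
    have "digit N i -` S \<in> sets borel"
      using measurable_sets[OF digit_measurable, of S i] by simp
    with a show ?case by auto
  qed auto
  then show "A \<in> sets borel" "A \<subseteq> {0..1}" by auto
qed

lemma unit_in_digit_algebra: "{0..1} \<in> digit_algebra N J"
  unfolding digit_algebra_def by (rule sigma_sets_top)

lemma digit_vimage_in_digit_algebra: "i \<in> J \<Longrightarrow> digit N i -` S \<inter> {0..1} \<in> digit_algebra N J"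
  unfolding digit_algebra_def by (rule sigma_sets.Basic) blast

lemma empty_in_digit_algebra: "{} \<in> digit_algebra N J"
  unfolding digit_algebra_def by (rule sigma_sets.Empty)

lemma digit_algebra_Diff: "A \<in> digit_algebra N J \<Longrightarrow> {0..1} - A \<in> digit_algebra N J"
  unfolding digit_algebra_def by (rule sigma_sets.Compl)

lemma digit_algebra_UN:
  "(\<And>i::nat. A i \<in> digit_algebra N J) \<Longrightarrow> (\<Union>i. A i) \<in> digit_algebra N J"
  unfolding digit_algebra_def by (rule sigma_sets.Union)

lemma digit_algebra_mono: "J \<subseteq> K \<Longrightarrow> digit_algebra N J \<subseteq> digit_algebra N K"
  unfolding digit_algebra_def by (intro sigma_sets_mono') blast

lemma renyi_funpow_range: "x \<in> {0..1} \<Longrightarrow> (renyi N ^^ k) x \<in> {0..1}"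
proof (induction k)
  case (Suc k)
  then show ?case using renyi_range[of "(renyi N ^^ k) x"] by auto
qed simp

lemma renyi_funpow_vimage_borel: "B \<in> sets borel \<Longrightarrow> (renyi N ^^ k) -` B \<in> sets borel"
  using measurable_sets[OF renyi_funpow_measurable] by simp

text \<open>The case \<open>i = 0\<close> has to be excluded: by truncated subtraction
  \<open>digit N 0\<close> coincides with \<open>digit N 1\<close>.\<close>

lemma digit_add: "i \<ge> 1 \<Longrightarrow> digit N (k + i) x = digit N i ((renyi N ^^ k) x)"
  by (simp add: digit_def funpow_add[symmetric, THEN fun_cong, unfolded comp_def] algebra_simps)

text \<open>The shift maps the generators of one algebra to those of the other, and generating a
  sigma-algebra commutes with taking preimages.\<close>

lemma digit_algebra_shift:
  assumes "n \<ge> 1"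
  shows "digit_algebra N {k + n..} = {(renyi N ^^ k) -` B \<inter> {0..1} | B. B \<in> digit_algebra N {n..}}"
proof -
  have gen: "{(renyi N ^^ k) -` A \<inter> {0..1} | A. A \<in> {digit N i -` S \<inter> {0..1} | i S. i \<in> {n..}}}
      = {digit N i -` S \<inter> {0..1} | i S. i \<in> {k + n..}}" (is "?L = ?R")
  proof (intro equalityI subsetI)
    fix X assume "X \<in> ?L"
    then obtain i S where X: "X = (renyi N ^^ k) -` (digit N i -` S \<inter> {0..1}) \<inter> {0..1}" and i: "i \<ge> n"
      by auto
    have "X = digit N (k + i) -` S \<inter> {0..1}"
      using i assms renyi_funpow_range unfolding X by (auto simp: digit_add)
    with i show "X \<in> ?R" by (auto intro!: exI[of _ "k + i"])
  next
    fix X assume "X \<in> ?R"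
    then obtain i S where X: "X = digit N i -` S \<inter> {0..1}" and i: "i \<ge> k + n" by auto
    have *: "digit N i x = digit N (i - k) ((renyi N ^^ k) x)" for x
      using digit_add[of "i - k" k x] i assms by simp
    have "X = (renyi N ^^ k) -` (digit N (i - k) -` S \<inter> {0..1}) \<inter> {0..1}"
      unfolding X using renyi_funpow_range by (auto simp only: * vimage_eq Int_iff)
    moreover have "digit N (i - k) -` S \<inter> {0..1} \<in> {digit N i -` S \<inter> {0..1} | i S. i \<in> {n..}}"
      using i by fastforce
    ultimately show "X \<in> ?L" by blast
  qed
  have "(renyi N ^^ k) \<in> {0..1} \<rightarrow> {0..1}"
    using renyi_funpow_range by auto
  from sigma_sets_vimage_commute[OF this] show ?thesis
    unfolding digit_algebra_def gen[symmetric] by simp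
qed

section \<open>Conditioning on the first digits\<close>

lemma digit_1_branch: "z \<in> {0..<1} \<Longrightarrow> digit N (Suc 0) (branch j z) = enat (N + j)"
  using floor_branch[of z j] by (simp add: digit_def digit1_def nat_plus_as_int)

lemma pull_vimage:
  assumes "\<And>z. z \<in> {0..<1} \<Longrightarrow> f (branch j z) = g z"
  shows "pull j (f -` S \<inter> {0..1}) = g -` S \<inter> {0..1} \<inter> {0..<1}"
proof (rule set_eqI)
  fix z :: real
  show "z \<in> pull j (f -` S \<inter> {0..1}) \<longleftrightarrow> z \<in> g -` S \<inter> {0..1} \<inter> {0..<1}"
    using assms[of z] branch_bounds[of z j] by (cases "z \<in> {0..<1}") (auto simp: pull_def)
qed

text \<open>Along a branch the first digit is constant and every later index drops by one;
  complements and unions follow by induction. The equality holds only after intersecting with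
  \<open>{0..<1}\<close>, because \<open>pull\<close> omits the endpoint.\<close>

lemma pull_digit_algebra:
  assumes "A \<in> digit_algebra N {1..Suc k}"
  shows "\<exists>A'\<in>digit_algebra N {1..k}. pull j A = A' \<inter> {0..<1}"
  using assms unfolding digit_algebra_def[of N "{1..Suc k}"]
proof (induction rule: sigma_sets.induct)
  case (Basic a)
  then obtain i S where a: "a = digit N i -` S \<inter> {0..1}" and i: "i \<in> {1..Suc k}" by blast
  show ?case
  proof (cases "i = 1")
    case True
    have dig: "digit N i (branch j z) = enat (N + j)" if "z \<in> {0..<1}" for z
      using True digit_1_branch[OF that] by simp
    let ?A = "if enat (N + j) \<in> S then {0..1} else {} :: real set"
    have "?A \<in> digit_algebra N {1..k}"
      using unit_in_digit_algebra empty_in_digit_algebra by simp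
    moreover have "pull j a = ?A \<inter> {0..<1}"
      unfolding a using pull_vimage[of "digit N i" j "\<lambda>_. enat (N + j)" S] dig by auto
    ultimately show ?thesis by (rule bexI[rotated])
  next
    case False
    then obtain i' where i': "i = 1 + i'" "i' \<in> {1..k}" using i by (cases i) auto
    have shift: "digit N i (branch j z) = digit N i' z" if "z \<in> {0..<1}" for z
      using digit_add[of i' 1 "branch j z"] i' floor_branch(3)[OF that] by simp
    have "digit N i' -` S \<inter> {0..1} \<in> digit_algebra N {1..k}"
      using i'(2) by (rule digit_vimage_in_digit_algebra)
    moreover have "pull j a = (digit N i' -` S \<inter> {0..1}) \<inter> {0..<1}"
      unfolding a by (rule pull_vimage) (rule shift)
    ultimately show ?thesis by (rule bexI[rotated])
  qed
next
  case Empty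
  then show ?case
    by (intro bexI[of _ "{}"]) (auto simp: pull_def empty_in_digit_algebra)
next
  case (Compl a)
  then obtain A' where A': "A' \<in> digit_algebra N {1..k}" "pull j a = A' \<inter> {0..<1}" by blast
  have branch_unit: "0 \<le> branch j z \<and> branch j z \<le> 1" if "0 \<le> z" "z < 1" for z
    using branch_bounds[of z j] that by simp
  have "pull j ({0..1} - a) = {0..<1} - pull j a"
    using branch_unit by (auto simp: pull_def)
  with A' show ?case
    by (intro bexI[OF _ digit_algebra_Diff[OF A'(1)]]) auto
next
  case (Union a)
  then have "\<forall>i. \<exists>A'. A' \<in> digit_algebra N {1..k} \<and> pull j (a i) = A' \<inter> {0..<1}" by blast
  then obtain A' where A': "\<And>i. A' i \<in> digit_algebra N {1..k}" "\<And>i. pull j (a i) = A' i \<inter> {0..<1}"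
    using choice[of "\<lambda>i A'. A' \<in> digit_algebra N {1..k} \<and> pull j (a i) = A' \<inter> {0..<1}"] by blast
  have "pull j (\<Union>i. a i) = (\<Union>i. pull j (a i))" by (auto simp: pull_def)
  with A' show ?case
    by (intro bexI[OF _ digit_algebra_UN[of A']]) auto
qed

text \<open>The analogue of the Broden--Borel--Levy formula.\<close>

lemma rho_t_first_digit:
  assumes A: "A \<in> digit_algebra N {1..Suc k}"
  obtains A' where "\<And>j. A' j \<in> digit_algebra N {1..k}"
    and "\<And>t. t \<in> {0..1} \<Longrightarrow>
      emeasure (rho_t N t) A = (\<Sum>j. ennreal (weight j t) * emeasure (rho_t N (branch j t)) (A' j))"
    and "\<And>t B. t \<in> {0..1} \<Longrightarrow> B \<in> sets borel \<Longrightarrow>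
      emeasure (rho_t N t) (A \<inter> (renyi N ^^ Suc k) -` B) =
      (\<Sum>j. ennreal (weight j t) * emeasure (rho_t N (branch j t)) (A' j \<inter> (renyi N ^^ k) -` B))"
proof -
  obtain A' where A': "\<And>j. A' j \<in> digit_algebra N {1..k}" "\<And>j. pull j A = A' j \<inter> {0..<1}"
    using pull_digit_algebra[OF A] by metis
  show ?thesis
  proof (rule that[of A'])
    fix t :: real assume t: "t \<in> {0..1}"
    \<comment> \<open>\<open>X = Y = UNIV\<close> will give the first equation. Preimages of
      \<open>B\<close> under \<open>Suc k\<close> and \<open>k\<close> iterates will give the
      second, since a branch cancels one iterate.\<close>
    have gen: "emeasure (rho_t N t) (A \<inter> X) = (\<Sum>j. ennreal (weight j t) * emeasure (rho_t N (branch j t)) (A' j \<inter> Y))"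
      if X: "X \<in> sets borel" and Y: "Y \<in> sets borel"
        and XY: "\<And>j z. z \<in> {0..<1} \<Longrightarrow> branch j z \<in> X \<longleftrightarrow> z \<in> Y" for X Y
    proof -
      have "pull j (A \<inter> X) = (A' j \<inter> Y) \<inter> {0..<1}" for j
        using XY A'(2)[of j] by (auto simp: pull_def set_eq_iff)
      moreover have "emeasure (rho_t N (branch j t)) ((A' j \<inter> Y) \<inter> {0..<1}) = emeasure (rho_t N (branch j t)) (A' j \<inter> Y)" for j
        using digit_algebra_borel[OF A'(1)[of j]] Y
        by (intro emeasure_rho_t_diff_1[OF branch_bounds[OF t]]) auto
      moreover have "A \<inter> X \<in> sets borel" "A \<inter> X \<subseteq> {0..1}"
        using digit_algebra_borel[OF A] X by auto
      ultimately show ?thesis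
        using t by (simp add: emeasure_rho_t_branches)
    qed
    show "emeasure (rho_t N t) A = (\<Sum>j. ennreal (weight j t) * emeasure (rho_t N (branch j t)) (A' j))"
      using gen[of UNIV UNIV] by simp
    fix B :: "real set" assume B: "B \<in> sets borel"
    show "emeasure (rho_t N t) (A \<inter> (renyi N ^^ Suc k) -` B) =
      (\<Sum>j. ennreal (weight j t) * emeasure (rho_t N (branch j t)) (A' j \<inter> (renyi N ^^ k) -` B))"
      by (intro gen renyi_funpow_vimage_borel B) (simp del: funpow.simps add: funpow_Suc_right floor_branch(3))
  qed (rule A')
qed

lemma emeasure_rho_t_unit: "t \<in> {0..1} \<Longrightarrow> emeasure (rho_t N t) {0..1} = 1"
  using prob_space.emeasure_space_1[OF prob_space_rho_t[OF N_ge_2]] by simp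

lemma digit_algebra_empty: "digit_algebra N {} = {{}, {0..1}}"
  by (auto simp: digit_algebra_def sigma_sets_empty_eq)

text \<open>Each digit of the past is peeled off by the first-digit formula, which replaces
  \<open>t\<close> by \<open>branch j t\<close>. The induction therefore ranges over all
  \<open>A\<close> and \<open>t\<close>, and \<open>c\<close> must bound every member of the
  family.\<close>

lemma rho_t_mixing_le:
  assumes B: "B \<in> sets borel" "B \<subseteq> {0..1}" and c: "\<And>s. s \<in> {0..1} \<Longrightarrow> emeasure (rho_t N s) B \<le> c"
    and "A \<in> digit_algebra N {1..k}" "t \<in> {0..1}"
  shows "emeasure (rho_t N t) (A \<inter> (renyi N ^^ k) -` B) \<le> c * emeasure (rho_t N t) A"
  using assms(4,5)
proof (induction k arbitrary: A t)
  case 0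
  then have "A = {} \<or> A = {0..1}" by (simp add: digit_algebra_empty)
  then show ?case
    using c[OF 0(2)] B(2) by (auto simp: Int_absorb1 emeasure_rho_t_unit[OF 0(2)])
next
  case (Suc k)
  obtain A' where A': "\<And>j. A' j \<in> digit_algebra N {1..k}"
    "\<And>t. t \<in> {0..1} \<Longrightarrow>
      emeasure (rho_t N t) A = (\<Sum>j. ennreal (weight j t) * emeasure (rho_t N (branch j t)) (A' j))"
    "\<And>t B. t \<in> {0..1} \<Longrightarrow> B \<in> sets borel \<Longrightarrow>
      emeasure (rho_t N t) (A \<inter> (renyi N ^^ Suc k) -` B) =
      (\<Sum>j. ennreal (weight j t) * emeasure (rho_t N (branch j t)) (A' j \<inter> (renyi N ^^ k) -` B))"
    using rho_t_first_digit[OF Suc.prems(1)] by blast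
  have "(\<Sum>j. ennreal (weight j t) * emeasure (rho_t N (branch j t)) (A' j \<inter> (renyi N ^^ k) -` B))
      \<le> (\<Sum>j. c * (ennreal (weight j t) * emeasure (rho_t N (branch j t)) (A' j)))"
    using Suc.IH[OF A'(1) branch_bounds[OF Suc.prems(2)]]
    by (intro suminf_le) (auto simp: mult.left_commute[of c] intro!: mult_left_mono)
  then show ?case
    unfolding A'(2)[OF Suc.prems(2)] A'(3)[OF Suc.prems(2) B(1)] by simp
qed

lemma rho_t_mixing_ge:
  assumes B: "B \<in> sets borel" "B \<subseteq> {0..1}" and c: "\<And>s. s \<in> {0..1} \<Longrightarrow> c \<le> emeasure (rho_t N s) B"
    and "A \<in> digit_algebra N {1..k}" "t \<in> {0..1}"
  shows "c * emeasure (rho_t N t) A \<le> emeasure (rho_t N t) (A \<inter> (renyi N ^^ k) -` B)"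
  using assms(4,5)
proof (induction k arbitrary: A t)
  case 0
  then have "A = {} \<or> A = {0..1}" by (simp add: digit_algebra_empty)
  then show ?case
    using c[OF 0(2)] B(2) by (auto simp: Int_absorb1 emeasure_rho_t_unit[OF 0(2)])
next
  case (Suc k)
  obtain A' where A': "\<And>j. A' j \<in> digit_algebra N {1..k}"
    "\<And>t. t \<in> {0..1} \<Longrightarrow>
      emeasure (rho_t N t) A = (\<Sum>j. ennreal (weight j t) * emeasure (rho_t N (branch j t)) (A' j))"
    "\<And>t B. t \<in> {0..1} \<Longrightarrow> B \<in> sets borel \<Longrightarrow>
      emeasure (rho_t N t) (A \<inter> (renyi N ^^ Suc k) -` B) =
      (\<Sum>j. ennreal (weight j t) * emeasure (rho_t N (branch j t)) (A' j \<inter> (renyi N ^^ k) -` B))"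
    using rho_t_first_digit[OF Suc.prems(1)] by blast
  have "(\<Sum>j. c * (ennreal (weight j t) * emeasure (rho_t N (branch j t)) (A' j)))
    \<le> (\<Sum>j. ennreal (weight j t) * emeasure (rho_t N (branch j t)) (A' j \<inter> (renyi N ^^ k) -` B))"
    using Suc.IH[OF A'(1) branch_bounds[OF Suc.prems(2)]]
    by (intro suminf_le) (auto simp: mult.left_commute[of c] intro!: mult_left_mono)
  then show ?case
    unfolding A'(2)[OF Suc.prems(2)] A'(3)[OF Suc.prems(2) B(1)] by simp
qed

subsection \<open>Cylinders and their parameters\<close>

text \<open>Words list the excess of each digit over \<open>N\<close>, so that their letters are the
  indices of \<open>branch\<close>; \<open>Suc i\<close> accounts for digits being counted from
  1.\<close>

definition cylinder :: "nat list \<Rightarrow> real set" where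
  "cylinder w = {x \<in> {0..1}. \<forall>i<length w. digit N (Suc i) x = enat (N + w ! i)}"

lemma cylinder_Nil: "cylinder [] = {0..1}"
  by (auto simp: cylinder_def)

lemma digit_algebra_Int:
  assumes "A \<in> digit_algebra N J" "B \<in> digit_algebra N J"
  shows "A \<inter> B \<in> digit_algebra N J"
proof -
  interpret sigma_algebra "{0..1}" "digit_algebra N J"
    unfolding digit_algebra_def by (rule sigma_algebra_sigma_sets) auto
  show ?thesis using assms by (rule Int)
qed

lemma cylinder_in_digit_algebra: "cylinder w \<in> digit_algebra N {1..length w}"
proof (induction w rule: rev_induct)
  case Nil
  then show ?case using unit_in_digit_algebra by (simp add: cylinder_Nil)
next
  case (snoc j w)
  have eq: "cylinder (w @ [j]) = cylinder w \<inter> (digit N (Suc (length w)) -` {enat (N + j)} \<inter> {0..1})"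
    by (auto simp: cylinder_def nth_append less_Suc_eq)
  have "digit N (Suc (length w)) -` {enat (N + j)} \<inter> {0..1} \<in> digit_algebra N {1..length (w @ [j])}"
    by (rule digit_vimage_in_digit_algebra) simp
  moreover have "cylinder w \<in> digit_algebra N {1..length (w @ [j])}"
    using snoc digit_algebra_mono[of "{1..length w}" "{1..length (w @ [j])}"] by auto
  ultimately show ?case unfolding eq by (rule digit_algebra_Int[rotated])
qed

lemma digit_Suc_branch: "z \<in> {0..<1} \<Longrightarrow> digit N (Suc (Suc i)) (branch j z) = digit N (Suc i) z"
  using digit_add[of "Suc i" 1 "branch j z"] by (simp add: floor_branch(3))

lemma branch_in_cylinder:
  assumes "z \<in> {0..<1}"
  shows "branch i z \<in> cylinder (j # w) \<longleftrightarrow> i = j \<and> z \<in> cylinder w"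
  using assms branch_bounds[of z i]
  by (auto simp: cylinder_def digit_1_branch digit_Suc_branch All_less_Suc2)

text \<open>Only \<open>branch j\<close> meets the cylinder, so the series over the branches
  collapses to one term.\<close>

lemma emeasure_rho_t_cylinder_Cons:
  assumes t: "t \<in> {0..1}" and X: "X \<in> sets borel" and Y: "Y \<in> sets borel"
    and XY: "\<And>z. z \<in> {0..<1} \<Longrightarrow> branch j z \<in> X \<longleftrightarrow> z \<in> Y"
  shows "emeasure (rho_t N t) (cylinder (j # w) \<inter> X)
    = ennreal (weight j t) * emeasure (rho_t N (branch j t)) (cylinder w \<inter> Y)"
proof -
  have pull: "pull i (cylinder (j # w) \<inter> X) = (if i = j then (cylinder w \<inter> Y) \<inter> {0..<1} else {})" for i
    using XY by (auto simp: pull_def branch_in_cylinder)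
  note cyl = digit_algebra_borel[OF cylinder_in_digit_algebra]
  have "emeasure (rho_t N t) (cylinder (j # w) \<inter> X)
      = (\<Sum>i. ennreal (weight i t) * emeasure (rho_t N (branch i t)) (pull i (cylinder (j # w) \<inter> X)))"
    using cyl[of "j # w"] X by (intro emeasure_rho_t_branches[OF t]) auto
  also have "\<dots> = (\<Sum>i\<in>{j}. ennreal (weight i t) * emeasure (rho_t N (branch i t)) (pull i (cylinder (j # w) \<inter> X)))"
    by (rule suminf_finite) (auto simp: pull)
  also have "\<dots> = ennreal (weight j t) * emeasure (rho_t N (branch j t)) ((cylinder w \<inter> Y) \<inter> {0..<1})"
    by (simp add: pull)
  also have "emeasure (rho_t N (branch j t)) ((cylinder w \<inter> Y) \<inter> {0..<1}) = emeasure (rho_t N (branch j t)) (cylinder w \<inter> Y)"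
    using cyl[of w] Y by (intro emeasure_rho_t_diff_1[OF branch_bounds[OF t]]) auto
  finally show ?thesis .
qed

lemma fold_branch_bounds: "t \<in> {0..1} \<Longrightarrow> fold branch w t \<in> {0..1}"
  by (induction w arbitrary: t) (simp_all only: fold_simps branch_bounds)

text \<open>Fixing the past completely makes the law of the future a single member of the family.
  Each digit sends the parameter through its branch, so the last letter of \<open>w\<close> acts
  last.\<close>

lemma emeasure_rho_t_cylinder:
  assumes "t \<in> {0..1}" and B: "B \<in> sets borel" "B \<subseteq> {0..1}"
  shows "emeasure (rho_t N t) (cylinder w \<inter> (renyi N ^^ length w) -` B)
    = emeasure (rho_t N t) (cylinder w) * emeasure (rho_t N (fold branch w t)) B"
  using assms(1)
proof (induction w arbitrary: t)
  case Nil
  then show ?case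
    using B by (simp add: cylinder_Nil emeasure_rho_t_unit Int_absorb1)
next
  case (Cons j w)
  have "emeasure (rho_t N t) (cylinder (j # w) \<inter> (renyi N ^^ length (j # w)) -` B)
    = ennreal (weight j t) * emeasure (rho_t N (branch j t)) (cylinder w \<inter> (renyi N ^^ length w) -` B)"
    by (intro emeasure_rho_t_cylinder_Cons renyi_funpow_vimage_borel Cons.prems B)
       (simp del: funpow.simps add: funpow_Suc_right floor_branch(3))
  also have "\<dots> = ennreal (weight j t) * emeasure (rho_t N (branch j t)) (cylinder w)
      * emeasure (rho_t N (fold branch w (branch j t))) B"
    by (simp add: Cons.IH[OF branch_bounds[OF Cons.prems]] mult.assoc)
  also have "ennreal (weight j t) * emeasure (rho_t N (branch j t)) (cylinder w) = emeasure (rho_t N t) (cylinder (j # w))"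
    using emeasure_rho_t_cylinder_Cons[OF Cons.prems, of UNIV UNIV j w] by simp
  finally show ?case by simp
qed

lemma emeasure_rho_t_cylinder_pos:
  assumes "t \<in> {0..1}"
  shows "0 < emeasure (rho_t N t) (cylinder w)"
  using assms
proof (induction w arbitrary: t)
  case Nil
  then show ?case by (simp add: cylinder_Nil emeasure_rho_t_unit)
next
  case (Cons j w)
  have "emeasure (rho_t N t) (cylinder (j # w)) = ennreal (weight j t) * emeasure (rho_t N (branch j t)) (cylinder w)"
    using emeasure_rho_t_cylinder_Cons[OF Cons.prems, of UNIV UNIV j w] by simp
  then show ?case
    using Cons.IH[OF branch_bounds[OF Cons.prems]] weight_pos[OF Cons.prems, of j]
    by (simp add: ennreal_zero_less_mult_iff)
qed

section \<open>Approximating an arbitrary parameter\<close>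

lemma branch_contraction:
  assumes "a \<in> {0..1}" "b \<in> {0..1}"
  shows "\<bar>branch j a - branch j b\<bar> \<le> \<bar>a - b\<bar> / 2"
proof -
  define n where "n = real N"
  define p where "p = n + real j + a"
  define q where "q = n + real j + b"
  have pq: "2 \<le> n" "n \<le> p" "n \<le> q" using assms N_ge_2 by (auto simp: n_def p_def q_def)
  have "branch j a - branch j b = n / q - n / p"
    by (simp add: branch_def n_def p_def q_def)
  also have "\<dots> = n * (a - b) / (p * q)"
  proof -
    have "n / q - n / p = n * (p - q) / (p * q)"
      using pq by (simp add: field_simps)
    then show ?thesis by (simp add: p_def q_def)
  qed
  finally have "\<bar>branch j a - branch j b\<bar> = n / (p * q) * \<bar>a - b\<bar>"
    using pq by (simp add: abs_mult)
  \<comment> \<open>Both \<open>p\<close> and \<open>q\<close> are at least \<open>n\<close>, so the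
    slope is at most \<open>1 / n\<close>; the factor \<open>1 / 2\<close> reflects
    \<open>N \<ge> 2\<close>.\<close>
  moreover have "n / (p * q) \<le> 1 / 2"
  proof -
    have "2 * n \<le> p * q" using pq by (intro mult_mono) auto
    then show ?thesis using pq by (simp add: field_simps)
  qed
  ultimately show ?thesis
    using mult_right_mono[of "n / (p * q)" "1 / 2" "\<bar>a - b\<bar>"] by simp
qed

text \<open>For \<open>t < 1\<close> the first digit of \<open>t\<close> becomes the last letter,
  preceded by a word approximating \<open>renyi N t\<close>; the contraction halves the error. The
  estimate is uniform in the starting parameter \<open>s\<close>, as needed when integrating over
  \<open>s\<close>.\<close>

lemma fold_branch_dense:
  assumes "t \<in> {0..1}"
  shows "\<exists>w. length w = k \<and> (\<forall>s\<in>{0..1}. \<bar>fold branch w s - t\<bar> \<le> (1 / 2) ^ k)"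
  using assms
proof (induction k arbitrary: t)
  case 0
  then show ?case by (intro exI[of _ "[]"]) auto
next
  case (Suc k)
  show ?case
  proof (cases "t = 1")
    \<comment> \<open>No branch takes the value 1 on \<open>{0..1}\<close>, so a large last letter
      \<open>m\<close> stands in for the infinite digit: \<open>branch m\<close> maps the whole
      interval close to 1. The zeros before it only supply the length.\<close>
    case True
    obtain m :: nat where m: "real N / (1 / 2) ^ Suc k < real m"
      using reals_Archimedean2 by blast
    have "\<bar>branch m s - 1\<bar> \<le> (1 / 2) ^ Suc k" if "s \<in> {0..1}" for s
    proof -
      have "real N < (1 / 2) ^ Suc k * real m"
        using m by (simp add: field_simps)
      also have "\<dots> \<le> (1 / 2) ^ Suc k * (real N + real m + s)"
        using that by (intro mult_left_mono) auto
      finally show ?thesis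
        using that N_ge_2 by (simp add: branch_def pos_divide_le_eq)
    qed
    then have "\<forall>s\<in>{0..1}. \<bar>fold branch (replicate k 0 @ [m]) s - t\<bar> \<le> (1 / 2) ^ Suc k"
      using fold_branch_bounds[of _ "replicate k 0"] True by (simp del: fold_replicate power_Suc)
    then show ?thesis
      by (intro exI[of _ "replicate k 0 @ [m]"]) simp
  next
    case False
    with Suc.prems have "t \<in> {0..<1}" by auto
    then obtain j where j: "renyi N t \<in> {0..<1}" "t = branch j (renyi N t)"
      by (rule branch_surj)
    then have R: "renyi N t \<in> {0..1}" by auto
    from Suc.IH[OF R] obtain w where w: "length w = k"
      "\<And>s. s \<in> {0..1} \<Longrightarrow> \<bar>fold branch w s - renyi N t\<bar> \<le> (1 / 2) ^ k" by blast
    have "\<bar>branch j (fold branch w s) - t\<bar> \<le> (1 / 2) ^ Suc k" if "s \<in> {0..1}" for s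
    proof -
      have "\<bar>branch j (fold branch w s) - branch j (renyi N t)\<bar> \<le> \<bar>fold branch w s - renyi N t\<bar> / 2"
        by (rule branch_contraction[OF fold_branch_bounds[OF that] R])
      with w(2)[OF that] show ?thesis unfolding j(2)[symmetric] by simp
    qed
    with w(1) show ?thesis by (intro exI[of _ "w @ [j]"]) simp
  qed
qed

text \<open>The density is jointly continuous on the compact unit square, hence uniformly so, and
  integrating over a set of length at most 1 preserves the error. Thus \<open>d\<close> does not
  depend on \<open>B\<close>; exchanging \<open>s\<close> and \<open>t\<close> gives the opposite
  bound.\<close>

lemma rho_t_uniformly_continuous:
  assumes e: "e > 0"
  obtains d where "d > 0" "\<And>s t B. s \<in> {0..1} \<Longrightarrow> t \<in> {0..1} \<Longrightarrow> \<bar>s - t\<bar> < d \<Longrightarrow> B \<in> sets borel \<Longrightarrow>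
    B \<subseteq> {0..1} \<Longrightarrow> emeasure (rho_t N s) B \<le> emeasure (rho_t N t) B + ennreal e"
proof -
  let ?g = "\<lambda>p. rho_t_dens (fst p) (snd p)"
  have nz: "(real N - (1 - snd p) * (1 - fst p))\<^sup>2 \<noteq> 0" if "p \<in> {0..1} \<times> {0..1}" for p :: "real \<times> real"
    using denom_pos[of "fst p" "snd p"] that by auto
  have "continuous_on ({0..1} \<times> {0..1}) ?g"
    unfolding rho_t_dens_def by (intro continuous_intros ballI nz)
  then have "uniformly_continuous_on ({0..1} \<times> {0..1}) ?g"
    by (intro compact_uniformly_continuous compact_Times) auto
  then obtain d where d: "d > 0" "\<And>p q. p \<in> {0..1} \<times> {0..1} \<Longrightarrow> q \<in> {0..1} \<times> {0..1} \<Longrightarrow>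
      dist q p < d \<Longrightarrow> dist (?g q) (?g p) < e"
    using e unfolding uniformly_continuous_on_def by meson
  show ?thesis
  proof (rule that[OF d(1)])
    fix s t :: real and B :: "real set"
    assume s: "s \<in> {0..1}" and t: "t \<in> {0..1}" and st: "\<bar>s - t\<bar> < d"
      and [measurable]: "B \<in> sets borel" and B: "B \<subseteq> {0..1}"
    have le: "rho_t_dens s x \<le> rho_t_dens t x + e" if "x \<in> {0..1}" for x
      using d(2)[of "(t, x)" "(s, x)"] s t st that by (auto simp: dist_Pair_Pair dist_real_def)
    have "emeasure (rho_t N s) B \<le> (\<integral>\<^sup>+x. ennreal (rho_t_dens t x) * indicator B x + ennreal e * indicator B x \<partial>lborel)"
      unfolding emeasure_rho_t[OF s \<open>B \<in> sets borel\<close> B]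
      using B le rho_t_dens_nonneg[OF t] e
      by (intro nn_integral_mono) (auto split: split_indicator simp: ennreal_plus[symmetric] simp del: ennreal_plus)
    also have "\<dots> = emeasure (rho_t N t) B + ennreal e * emeasure lborel B"
      using t B by (subst nn_integral_add) (auto simp: emeasure_rho_t nn_integral_cmult_indicator)
    also have "emeasure lborel B \<le> emeasure lborel {0..1::real}"
      using B by (intro emeasure_mono) auto
    finally show "emeasure (rho_t N s) B \<le> emeasure (rho_t N t) B + ennreal e"
      by (simp add: mult_left_mono add_left_mono)
  qed
qed

subsection \<open>Mixing coefficients\<close>

lemma emeasure_rho_t_eq_measure: "t \<in> {0..1} \<Longrightarrow> emeasure (rho_t N t) A = ennreal (measure (rho_t N t) A)"
  by (rule finite_measure.emeasure_eq_measure)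
     (simp add: prob_space.finite_measure prob_space_rho_t N_ge_2)

lemma emeasure_rho_eq_measure: "emeasure (rho N) A = ennreal (measure (rho N) A)"
  by (rule finite_measure.emeasure_eq_measure)
     (simp add: prob_space.finite_measure prob_space_rho N_ge_2)

lemma measure_rho_t_le:
  assumes "t \<in> {0..1}" "B \<in> sets borel" "B \<subseteq> {0..1}"
  shows "measure (rho_t N t) B \<le> 2 * measure (rho N) B"
proof -
  have "ennreal (measure (rho_t N t) B) \<le> ennreal 2 * ennreal (measure (rho N) B)"
    using emeasure_rho_t_le[OF assms] emeasure_rho_t_eq_measure[OF assms(1), of B]
      emeasure_rho_eq_measure[of B] by simp
  also have "\<dots> = ennreal (2 * measure (rho N) B)"
    by (rule ennreal_mult[symmetric]) auto
  finally show ?thesis by (simp add: ennreal_le_iff)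
qed

text \<open>The domination by \<open>2 * rho N\<close> makes the supremum at most 1. It also extends
  the last estimate to events that are null for \<open>rho N\<close>, which the supremum
  skips.\<close>

lemma eps_eq_ereal:
  obtains e where "eps N n = ereal e" "0 \<le> e" "e \<le> 1"
    "\<And>t B. t \<in> {0..1} \<Longrightarrow> B \<in> digit_algebra N {n..} \<Longrightarrow>
      \<bar>measure (rho_t N t) B - measure (rho N) B\<bar> \<le> e * measure (rho N) B"
proof -
  let ?S = "{ereal \<bar>measure (rho_t N t) B / measure (rho N) B - 1\<bar> | t B.
            t \<in> {0..1} \<and> B \<in> digit_algebra N {n..} \<and> measure (rho N) B > 0}"
  have "eps N n \<le> 1"
    unfolding eps_def
  proof (rule Sup_least)
    fix x assume "x \<in> ?S"
    then obtain t B where x: "x = ereal \<bar>measure (rho_t N t) B / measure (rho N) B - 1\<bar>"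
      and t: "t \<in> {0..1}" and B: "B \<in> digit_algebra N {n..}" and pos: "measure (rho N) B > 0" by blast
    have "measure (rho_t N t) B / measure (rho N) B \<le> 2"
      using measure_rho_t_le[OF t digit_algebra_borel[OF B]] pos by (simp add: pos_divide_le_eq)
    moreover have "0 \<le> measure (rho_t N t) B / measure (rho N) B" by simp
    ultimately show "x \<le> 1" unfolding x by (simp add: one_ereal_def abs_le_iff del: ereal_eq_1)
  qed
  moreover have "0 \<le> eps N n"
  proof -
    \<comment> \<open>The full interval contributes the value 0, so the supremum is not taken over
      the empty set.\<close>
    have "measure (rho N) {0..1} = 1" "measure (rho_t N 0) {0..1} = 1"
      using prob_space.prob_space[OF prob_space_rho[OF N_ge_2]]
        prob_space.prob_space[OF prob_space_rho_t[OF N_ge_2, of 0]] by simp_all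
    then have "0 \<in> ?S"
      by (intro CollectI exI[of _ 0] exI[of _ "{0..1}"]) (auto simp: unit_in_digit_algebra)
    then show ?thesis unfolding eps_def by (rule Sup_upper)
  qed
  ultimately obtain e where e: "eps N n = ereal e" "0 \<le> e" "e \<le> 1"
    by (cases "eps N n") (auto simp: one_ereal_def)
  show ?thesis
  proof (rule that[OF e])
    fix t B assume t: "t \<in> {0..1::real}" and B: "B \<in> digit_algebra N {n..}"
    show "\<bar>measure (rho_t N t) B - measure (rho N) B\<bar> \<le> e * measure (rho N) B"
    proof (cases "measure (rho N) B = 0")
      case True
      with measure_rho_t_le[OF t digit_algebra_borel[OF B]] have "measure (rho_t N t) B = 0"
        by (simp add: measure_le_0_iff)
      with True show ?thesis by simp
    next
      case False
      then have pos: "measure (rho N) B > 0" by (simp add: zero_less_measure_iff)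
      with t B have "ereal \<bar>measure (rho_t N t) B / measure (rho N) B - 1\<bar> \<le> eps N n"
        unfolding eps_def by (intro Sup_upper) blast
      then have "\<bar>measure (rho_t N t) B / measure (rho N) B - 1\<bar> \<le> e" by (simp add: e)
      moreover have "measure (rho_t N t) B - measure (rho N) B
          = (measure (rho_t N t) B / measure (rho N) B - 1) * measure (rho N) B"
        using pos by (simp add: field_simps)
      ultimately show ?thesis
        using pos by (simp add: abs_mult mult_right_mono)
    qed
  qed
qed

lemma nn_integral_rho_cmult:
  assumes "A \<in> sets borel" "A \<subseteq> {0..1}"
  shows "(\<integral>\<^sup>+t. c * emeasure (rho_t N t) A \<partial>rho N) = c * emeasure (rho N) A"
  using emeasure_rho_t_measurable[OF assms] rho_mixture[OF assms] by (simp add: nn_integral_cmult)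

text \<open>\<open>B\<close> is the preimage of some \<open>B'\<close> under \<open>k\<close>
  iterates and, by invariance, has the same mass \<open>b\<close> under \<open>rho N\<close>. All
  \<open>rho_t N s\<close> give \<open>B'\<close> a mass between \<open>(1 - e) * b\<close> and
  \<open>(1 + e) * b\<close>, so the two mixing lemmas apply; the second claim follows by
  integrating over the parameter.\<close>

lemma measure_mixing:
  assumes e: "0 \<le> e" "e \<le> 1" and n: "n \<ge> 1"
    and eps: "\<And>t B. t \<in> {0..1} \<Longrightarrow> B \<in> digit_algebra N {n..} \<Longrightarrow>
      \<bar>measure (rho_t N t) B - measure (rho N) B\<bar> \<le> e * measure (rho N) B"
    and A: "A \<in> digit_algebra N {1..k}" and B: "B \<in> digit_algebra N {k + n..}"
  shows "t \<in> {0..1} \<Longrightarrow> \<bar>measure (rho_t N t) (A \<inter> B) - measure (rho_t N t) A * measure (rho N) B\<bar>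
      \<le> e * (measure (rho_t N t) A * measure (rho N) B)"
    and "\<bar>measure (rho N) (A \<inter> B) - measure (rho N) A * measure (rho N) B\<bar>
      \<le> e * (measure (rho N) A * measure (rho N) B)"
proof -
  obtain B' where B': "B' \<in> digit_algebra N {n..}" and B_eq: "B = (renyi N ^^ k) -` B' \<inter> {0..1}"
    using B unfolding digit_algebra_shift[OF n] by blast
  define b where "b = measure (rho N) B'"
  note bB' = digit_algebra_borel[OF B'] and bA = digit_algebra_borel[OF A] and bB = digit_algebra_borel[OF B]
  have b: "measure (rho N) B = b"
    using rho_invariant_funpow[OF bB', of k] by (simp add: B_eq b_def measure_def)
  have b0: "0 \<le> b" by (simp add: b_def)
  have AB: "A \<inter> (renyi N ^^ k) -` B' = A \<inter> B"
    using bA(2) by (auto simp: B_eq)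
  have bAB: "A \<inter> B \<in> sets borel" "A \<inter> B \<subseteq> {0..1}" using bA bB by auto
  have up: "emeasure (rho_t N s) B' \<le> ennreal ((1 + e) * b)" if "s \<in> {0..1}" for s
    using eps[OF that B'] that
    by (auto simp: emeasure_rho_t_eq_measure b_def[symmetric] algebra_simps abs_le_iff intro!: ennreal_leI)
  have lo: "ennreal ((1 - e) * b) \<le> emeasure (rho_t N s) B'" if "s \<in> {0..1}" for s
    using eps[OF that B'] that
    by (auto simp: emeasure_rho_t_eq_measure b_def[symmetric] algebra_simps abs_le_iff intro!: ennreal_leI)
  have up_t: "emeasure (rho_t N s) (A \<inter> B) \<le> ennreal ((1 + e) * b) * emeasure (rho_t N s) A"
    and lo_t: "ennreal ((1 - e) * b) * emeasure (rho_t N s) A \<le> emeasure (rho_t N s) (A \<inter> B)"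
    if "s \<in> {0..1}" for s
    using rho_t_mixing_le[OF bB' up A that] rho_t_mixing_ge[OF bB' lo A that] by (simp_all add: AB)
  have conv: "\<bar>z - x * b\<bar> \<le> e * (x * b)"
    if "ennreal z \<le> ennreal ((1 + e) * b) * ennreal x" "ennreal ((1 - e) * b) * ennreal x \<le> ennreal z"
      "0 \<le> x" "0 \<le> z" for x z
  proof -
    \<comment> \<open>\<open>e \<le> 1\<close> keeps \<open>(1 - e) * b\<close> nonnegative, so that
      the products in \<open>ennreal\<close> are the real ones.\<close>
    have "z \<le> (1 + e) * b * x" "(1 - e) * b * x \<le> z"
      using that e b0 by (auto simp: ennreal_mult[symmetric] ennreal_le_iff)
    then show ?thesis by (simp add: abs_le_iff algebra_simps)
  qed
  {
    assume t: "t \<in> {0..1}"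
    show "\<bar>measure (rho_t N t) (A \<inter> B) - measure (rho_t N t) A * measure (rho N) B\<bar>
      \<le> e * (measure (rho_t N t) A * measure (rho N) B)"
      unfolding b using up_t[OF t] lo_t[OF t] t
      by (intro conv) (auto simp: emeasure_rho_t_eq_measure)
  }
  have "emeasure (rho N) (A \<inter> B) \<le> ennreal ((1 + e) * b) * emeasure (rho N) A"
    unfolding rho_mixture[OF bAB] nn_integral_rho_cmult[OF bA, symmetric]
    by (intro nn_integral_mono up_t) simp
  moreover have "ennreal ((1 - e) * b) * emeasure (rho N) A \<le> emeasure (rho N) (A \<inter> B)"
    unfolding rho_mixture[OF bAB] nn_integral_rho_cmult[OF bA, symmetric]
    by (intro nn_integral_mono lo_t) simp
  ultimately show "\<bar>measure (rho N) (A \<inter> B) - measure (rho N) A * measure (rho N) B\<bar>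
      \<le> e * (measure (rho N) A * measure (rho N) B)"
    unfolding b by (intro conv) (auto simp: emeasure_rho_eq_measure)
qed

text \<open>\<open>measure_mixing\<close> compares the joint mass with \<open>x * b\<close>, where
  \<open>b\<close> is the mass of \<open>B\<close> under \<open>rho N\<close>. Replacing
  \<open>b\<close> by the mass \<open>y\<close> under \<open>rho_t N t\<close> costs a second error
  term in the numerator and, on dividing, the factor \<open>1 / (1 - e')\<close>.\<close>

lemma psi_mixing_rho_t_le:
  assumes t: "t \<in> {0..1}" and n: "n \<ge> 1"
  shows "psi_mixing N (rho_t N t) n \<le> (eps N n + eps N (n + 1)) / (1 - eps N (n + 1))"
proof -
  obtain e where e: "eps N n = ereal e" "0 \<le> e" "e \<le> 1"
    "\<And>t B. t \<in> {0..1} \<Longrightarrow> B \<in> digit_algebra N {n..} \<Longrightarrow>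
      \<bar>measure (rho_t N t) B - measure (rho N) B\<bar> \<le> e * measure (rho N) B"
    using eps_eq_ereal[of n] by blast
  obtain e' where e': "eps N (n + 1) = ereal e'" "0 \<le> e'" "e' \<le> 1"
    "\<And>t B. t \<in> {0..1} \<Longrightarrow> B \<in> digit_algebra N {n + 1..} \<Longrightarrow>
      \<bar>measure (rho_t N t) B - measure (rho N) B\<bar> \<le> e' * measure (rho N) B"
    using eps_eq_ereal[of "n + 1"] by blast
  show ?thesis
  proof (cases "e' = 1")
    case True
    \<comment> \<open>The denominator vanishes, and the extended real quotient of a positive number by zero is infinite.\<close>
    have "(eps N n + eps N (n + 1)) / (1 - eps N (n + 1)) = \<infinity>"
      using e(2) True unfolding e(1) e'(1) by (simp add: one_ereal_def[symmetric] divide_ereal_def)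
    then show ?thesis by simp
  next
    case False
    then have e'1: "e' < 1" using e' by simp
    have eq: "(eps N n + eps N (n + 1)) / (1 - eps N (n + 1)) = ereal ((e + e') / (1 - e'))"
      using e'1 unfolding e(1) e'(1) by (simp add: one_ereal_def)
    show ?thesis
      unfolding eq psi_mixing_def
    proof (rule Sup_least, clarify, unfold ereal_less_eq(3))
      fix k A B
      assume k: "1 \<le> k" and A: "A \<in> digit_algebra N {1..k}" and B: "B \<in> digit_algebra N {k + n..}"
        and nz: "measure (rho_t N t) A * measure (rho_t N t) B \<noteq> 0"
      define x y z b where "x = measure (rho_t N t) A" and "y = measure (rho_t N t) B"
        and "z = measure (rho_t N t) (A \<inter> B)" and "b = measure (rho N) B"
      have x: "x > 0" and y: "y > 0" and b: "b \<ge> 0"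
        using nz by (auto simp: x_def y_def b_def zero_less_measure_iff)
      have z: "\<bar>z - x * b\<bar> \<le> e * (x * b)"
        using measure_mixing(1)[OF e(2,3) n e(4) A B t] by (simp add: x_def z_def b_def)
      \<comment> \<open>Since \<open>k \<ge> 1\<close>, the event depends only on digits from
        \<open>n + 1\<close> on; this is where \<open>eps N (n + 1)\<close> enters.\<close>
      have "B \<in> digit_algebra N {n + 1..}"
        using B k digit_algebra_mono[of "{k + n..}" "{n + 1..}"] by auto
      then have yb: "\<bar>y - b\<bar> \<le> e' * b"
        using e'(4)[OF t] by (simp add: y_def b_def)
      have "\<bar>z - x * y\<bar> \<le> \<bar>z - x * b\<bar> + \<bar>x * (y - b)\<bar>"
        by (simp add: algebra_simps)
      also have "\<bar>x * (y - b)\<bar> \<le> x * (e' * b)"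
        using yb x by (simp add: abs_mult mult_left_mono)
      finally have 1: "\<bar>z - x * y\<bar> \<le> x * ((e + e') * b)"
        using z by (simp add: algebra_simps)
      \<comment> \<open>The lower estimate for \<open>y\<close> bounds \<open>b\<close> by a
        multiple of \<open>y\<close> and so yields the denominator of the claim.\<close>
      have "(1 - e') * b \<le> y" using yb by (simp add: abs_le_iff algebra_simps)
      then have "b \<le> y / (1 - e')"
        using e'1 by (simp add: pos_le_divide_eq mult.commute)
      then have "(e + e') * b \<le> (e + e') * (y / (1 - e'))"
        using e e' by (intro mult_left_mono) auto
      then have "x * ((e + e') * b) \<le> x * ((e + e') * (y / (1 - e')))"
        using x by (rule mult_left_mono[OF _ less_imp_le])
      with 1 have "\<bar>z - x * y\<bar> \<le> (e + e') / (1 - e') * (x * y)"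
        by (simp add: algebra_simps)
      moreover have "\<bar>z / (x * y) - 1\<bar> = \<bar>z - x * y\<bar> / (x * y)"
      proof -
        have "z / (x * y) - 1 = (z - x * y) / (x * y)"
          using x y by (simp add: diff_divide_distrib)
        then show ?thesis using x y by (simp add: abs_mult)
      qed
      ultimately show "\<bar>measure (rho_t N t) (A \<inter> B) / (measure (rho_t N t) A * measure (rho_t N t) B) - 1\<bar> \<le> (e + e') / (1 - e')"
        using x y by (simp add: pos_divide_le_eq x_def[symmetric] y_def[symmetric] z_def[symmetric])
    qed
  qed
qed

lemma psi_mixing_rho_le:
  assumes n: "n \<ge> 1"
  shows "psi_mixing N (rho N) n \<le> eps N n"
proof -
  obtain e where e: "eps N n = ereal e" "0 \<le> e" "e \<le> 1"
    "\<And>t B. t \<in> {0..1} \<Longrightarrow> B \<in> digit_algebra N {n..} \<Longrightarrow>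
      \<bar>measure (rho_t N t) B - measure (rho N) B\<bar> \<le> e * measure (rho N) B"
    using eps_eq_ereal[of n] by blast
  show ?thesis
    unfolding e(1) psi_mixing_def
  proof (rule Sup_least, clarify, unfold ereal_less_eq(3))
    fix k A B
    assume A: "A \<in> digit_algebra N {1..k}" and B: "B \<in> digit_algebra N {k + n..}"
      and nz: "measure (rho N) A * measure (rho N) B \<noteq> 0"
    define m where "m = measure (rho N) A * measure (rho N) B"
    have m: "m > 0" using nz by (simp add: m_def zero_less_measure_iff less_le)
    have "\<bar>measure (rho N) (A \<inter> B) - m\<bar> \<le> e * m"
      using measure_mixing(2)[OF e(2,3) n e(4) A B] by (simp add: m_def)
    moreover have "measure (rho N) (A \<inter> B) / m - 1 = (measure (rho N) (A \<inter> B) - m) / m"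
      using m by (simp add: diff_divide_distrib)
    ultimately show "\<bar>measure (rho N) (A \<inter> B) / (measure (rho N) A * measure (rho N) B) - 1\<bar> \<le> e"
      using m by (simp add: m_def[symmetric] pos_divide_le_eq)
  qed
qed

text \<open>For given \<open>t\<close> and \<open>B\<close>, a cylinder \<open>P\<close> is chosen
  whose word drives every parameter close to \<open>t\<close>, and \<open>Q\<close> is
  \<open>B\<close> shifted past it. Under \<open>rho N\<close> the conditional probability of
  \<open>Q\<close> given \<open>P\<close> is then close to the mass of \<open>B\<close> under
  \<open>rho_t N t\<close>, while \<open>Q\<close> itself has the mass of \<open>B\<close> by
  invariance.\<close>

lemma eps_le_psi_mixing_rho:
  assumes n: "n \<ge> 1"
  shows "eps N n \<le> psi_mixing N (rho N) n"
  unfolding eps_def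
proof (rule Sup_least, clarify)
  fix t B assume t: "t \<in> {0..1::real}" and B: "B \<in> digit_algebra N {n..}" and pos: "0 < measure (rho N) B"
  note bB = digit_algebra_borel[OF B]
  define r where "r = measure (rho_t N t) B"
  define b where "b = measure (rho N) B"
  have b: "b > 0" using pos by (simp add: b_def)
  have r: "r \<ge> 0" by (simp add: r_def)
  show "ereal \<bar>measure (rho_t N t) B / measure (rho N) B - 1\<bar> \<le> psi_mixing N (rho N) n"
  proof (rule ereal_le_epsilon2)
    fix \<delta> :: real assume \<delta>: "0 < \<delta>"
    \<comment> \<open>The error in the conditional probability is finally divided by
      \<open>b\<close>, which leaves \<open>\<delta>\<close>.\<close>
    define e where "e = \<delta> * b"
    have e: "e > 0" using \<delta> b by (simp add: e_def)
    obtain d where d: "d > 0" "\<And>s t B. s \<in> {0..1} \<Longrightarrow> t \<in> {0..1} \<Longrightarrow> \<bar>s - t\<bar> < d \<Longrightarrow> B \<in> sets borel \<Longrightarrow>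
        B \<subseteq> {0..1} \<Longrightarrow> emeasure (rho_t N s) B \<le> emeasure (rho_t N t) B + ennreal e"
      using rho_t_uniformly_continuous[OF e] by blast
    obtain k0 where k0: "(1 / 2) ^ k0 < d"
      using real_arch_pow_inv[OF d(1), of "1 / 2"] by auto
    \<comment> \<open>The successor guarantees \<open>k \<ge> 1\<close>, as the supremum in
      \<open>psi_mixing\<close> demands.\<close>
    define k where "k = Suc k0"
    have k: "(1 / 2) ^ k < d" using k0 by (simp add: k_def) (use zero_less_power[of "1/2::real" k0] in linarith)
    obtain w where w: "length w = k" "\<And>s. s \<in> {0..1} \<Longrightarrow> \<bar>fold branch w s - t\<bar> \<le> (1 / 2) ^ k"
      using fold_branch_dense[OF t, of k] by blast
    define P where "P = cylinder w"
    define Q where "Q = (renyi N ^^ k) -` B \<inter> {0..1}"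
    have P: "P \<in> digit_algebra N {1..k}"
      using cylinder_in_digit_algebra[of w] by (simp add: P_def w(1))
    have Q: "Q \<in> digit_algebra N {k + n..}"
      unfolding digit_algebra_shift[OF n] Q_def using B by blast
    note bP = digit_algebra_borel[OF P] and bQ = digit_algebra_borel[OF Q]
    have bPQ: "P \<inter> Q \<in> sets borel" "P \<inter> Q \<subseteq> {0..1}" using bP bQ by auto
    have PQ: "P \<inter> Q = cylinder w \<inter> (renyi N ^^ length w) -` B"
      using bP(2) by (auto simp: P_def Q_def w(1))
    define p where "p = measure (rho N) P"
    define q where "q = measure (rho N) (P \<inter> Q)"
    have Qb: "measure (rho N) Q = b"
      using rho_invariant_funpow[OF bB, of k] by (simp add: Q_def b_def measure_def)
    have step: "emeasure (rho_t N s) (P \<inter> Q) = emeasure (rho_t N (fold branch w s)) B * emeasure (rho_t N s) P"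
      if "s \<in> {0..1}" for s
      using emeasure_rho_t_cylinder[OF that bB, of w] by (subst PQ) (simp only: P_def mult.commute)
    have close: "\<bar>fold branch w s - t\<bar> < d" if "s \<in> {0..1}" for s
      using w(2)[OF that] k by simp
    have "emeasure (rho N) (P \<inter> Q) \<le> ennreal (r + e) * emeasure (rho N) P"
      unfolding rho_mixture[OF bPQ] nn_integral_rho_cmult[OF bP, symmetric]
    proof (rule nn_integral_mono)
      fix s assume "s \<in> space (rho N)"
      then have s: "s \<in> {0..1}" by simp
      have "emeasure (rho_t N (fold branch w s)) B \<le> ennreal (r + e)"
        using d(2)[OF fold_branch_bounds[OF s] t close[OF s] bB] r e
        by (simp add: r_def emeasure_rho_t_eq_measure[OF t] ennreal_plus)
      then show "emeasure (rho_t N s) (P \<inter> Q) \<le> ennreal (r + e) * emeasure (rho_t N s) P"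
        unfolding step[OF s] by (rule mult_right_mono) simp
    qed
    then have "ennreal q \<le> ennreal ((r + e) * p)"
      using r e by (simp add: q_def p_def emeasure_rho_eq_measure ennreal_mult del: ennreal_plus)
    then have up: "q \<le> (r + e) * p"
      using r e by (simp add: p_def ennreal_le_iff)
    \<comment> \<open>The lower bound is stated with a sum on the right, which avoids the truncated
      subtraction of \<open>ennreal\<close>.\<close>
    have "ennreal r * emeasure (rho N) P \<le> emeasure (rho N) (P \<inter> Q) + ennreal e * emeasure (rho N) P"
      unfolding rho_mixture[OF bPQ] nn_integral_rho_cmult[OF bP, symmetric]
    proof (subst nn_integral_add[symmetric])
      show "(\<integral>\<^sup>+t. ennreal r * emeasure (rho_t N t) P \<partial>rho N)
        \<le> (\<integral>\<^sup>+t. emeasure (rho_t N t) (P \<inter> Q) + ennreal e * emeasure (rho_t N t) P \<partial>rho N)"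
      proof (rule nn_integral_mono)
        fix s assume "s \<in> space (rho N)"
        then have s: "s \<in> {0..1}" by simp
        have "ennreal r \<le> emeasure (rho_t N (fold branch w s)) B + ennreal e"
          using d(2)[OF t fold_branch_bounds[OF s] _ bB] close[OF s]
          by (simp add: r_def emeasure_rho_t_eq_measure[OF t, symmetric] abs_minus_commute)
        then show "ennreal r * emeasure (rho_t N s) P
            \<le> emeasure (rho_t N s) (P \<inter> Q) + ennreal e * emeasure (rho_t N s) P"
          unfolding step[OF s] distrib_right[symmetric] by (rule mult_right_mono) simp
      qed
    qed (use emeasure_rho_t_measurable[OF bPQ] emeasure_rho_t_measurable[OF bP] in auto)
    then have "ennreal (r * p) \<le> ennreal (q + e * p)"
      using r e by (simp add: q_def p_def emeasure_rho_eq_measure ennreal_mult)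
    then have lo: "r * p \<le> q + e * p"
      using e by (simp add: p_def q_def ennreal_le_iff del: ennreal_plus)
    \<comment> \<open>Positivity of the cylinder is known for \<open>rho_t N t\<close> and passes to
      \<open>rho N\<close> by domination.\<close>
    have p: "p > 0"
    proof -
      have "0 < emeasure (rho_t N t) P"
        unfolding P_def by (rule emeasure_rho_t_cylinder_pos[OF t])
      also have "\<dots> \<le> 2 * emeasure (rho N) P"
        by (rule emeasure_rho_t_le[OF t bP])
      finally show ?thesis
        by (auto simp: p_def emeasure_rho_eq_measure zero_less_measure_iff)
    qed
    have "ereal \<bar>q / (p * b) - 1\<bar> \<le> psi_mixing N (rho N) n"
      unfolding psi_mixing_def
    proof (rule Sup_upper, intro CollectI exI conjI)
      show "ereal \<bar>q / (p * b) - 1\<bar> = ereal \<bar>measure (rho N) (P \<inter> Q) / (measure (rho N) P * measure (rho N) Q) - 1\<bar>"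
        by (simp add: q_def p_def Qb)
      show "1 \<le> k" by (simp add: k_def)
      show "measure (rho N) P * measure (rho N) Q \<noteq> 0"
        using p b by (simp add: Qb p_def)
    qed (rule P Q)+
    moreover have "\<bar>r / b - 1\<bar> \<le> \<bar>q / (p * b) - 1\<bar> + \<delta>"
    proof -
      have "q / p \<le> r + e" using up p by (simp add: pos_divide_le_eq)
      moreover have "r - e \<le> q / p" using lo p by (simp add: pos_le_divide_eq left_diff_distrib)
      ultimately have "\<bar>r - q / p\<bar> \<le> \<delta> * b" by (simp add: e_def abs_le_iff)
      moreover have "r / b - q / (p * b) = (r - q / p) / b"
        by (simp add: diff_divide_distrib)
      ultimately have "\<bar>r / b - q / (p * b)\<bar> \<le> \<delta>"
        using b by (simp add: pos_divide_le_eq)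
      moreover have "\<bar>u - 1\<bar> \<le> \<bar>v - 1\<bar> + \<delta>" if "\<bar>u - v\<bar> \<le> \<delta>" for u v :: real
        using that by linarith
      ultimately show ?thesis by blast
    qed
    ultimately show "ereal \<bar>measure (rho_t N t) B / measure (rho N) B - 1\<bar> \<le> psi_mixing N (rho N) n + ereal \<delta>"
      unfolding r_def[symmetric] b_def[symmetric]
      by (metis add_right_mono ereal_less_eq(3) order_trans plus_ereal.simps(1))
  qed
qed

end

theorem theorem4p2:
  fixes N :: nat
  assumes "N \<ge> 2"
  shows "(\<forall>t\<in>{0..1}. \<forall>n\<ge>1.
            psi_mixing N (rho_t N t) n \<le> (eps N n + eps N (n + 1)) / (1 - eps N (n + 1)))
       \<and> (\<forall>n\<ge>1. psi_mixing N (rho N) n = eps N n)"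
proof -
  interpret renyi_type_map N
    using assms by unfold_locales
  show ?thesis
    using psi_mixing_rho_t_le psi_mixing_rho_le eps_le_psi_mixing_rho by (auto intro: antisym)
qed

end
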